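(* Let $(a_n)_{n\ge 1}$ and $(b_n)_{n\ge 1}$ be such that all the random variables $a_1,b_1,a_2,b_2,\ldots$ are iid and square integrable, with $\mathbb{E}[a_1]=0$ and $\mathbb{E}[a_1^2]=1$, and suppose that their common law admits a density $\rho:\mathbb{R}\to(0,\infty)$ of the form $\rho=e^{-\Psi}$, where $\Psi:\mathbb{R}\to\mathbb{R}$ is $C^\infty$ and satisfies $$\Psi^{(p)}\in\bigcap_{q\ge 1}L^q\big(e^{-\Psi(x)}\,dx\big)\quad\text{for all } p\ge 1 .$$ For $N\ge 1$ let $$X_N(t)=\frac{1}{\sqrt N}\sum_{n=1}^N\Big\{a_n\cos\Big(\frac{nt}{N}\Big)+b_n\sin\Big(\frac{nt}{N}\Big)\Big\},\quad t\in\mathbb{R}.$$ Let $W$ be the centered stationary Gaussian process with covariance function $\mathbb{E}[W(s)W(t)]=\frac{\sin(t-s)}{t-s}$ (equal to $1$ when $s=t$). Then, for any compact interval $I\subset\mathbb{R}$, the number $Z_{X_N}(I)$ of zeros of $X_N$ in $I$ converges in distribution, as $N\to\infty$, to the number $Z_W(I)$ of zeros of $W$ in $I$.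
   Context: For a process $Y$ and an interval $I$, $Z_Y(I)$ denotes the number of points $t\in I$ with $Y(t)=0$. The process $W$ is indexed by $\mathbb{R}$ and taken in its version with smooth sample paths. $\Psi^{(p)}$ denotes the $p$-th derivative of $\Psi$. *)

theory Defs
  imports "HOL-Probability.Probability"
begin

(* The counting measure makes the number of zeros [0,\<infinity>]-valued, so that an infinite zero set
   counts as \<infinity> (whereas card would give 0). *)
definition zeros :: "(real \<Rightarrow> real) \<Rightarrow> real set \<Rightarrow> ennreal" where
  "zeros y I = emeasure (count_space UNIV) {t \<in> I. y t = 0}"

(* The library's weak_conv_m only covers laws on the reals; the two notions agree there, see
   converges_in_distribution_real_iff. The random variables may live on different spaces. *)
definition converges_in_distribution ::
  "'a measure \<Rightarrow> (nat \<Rightarrow> 'a \<Rightarrow> 'c::topological_space) \<Rightarrow> 'b measure \<Rightarrow> ('b \<Rightarrow> 'c) \<Rightarrow> bool" where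
  "converges_in_distribution M X M' Y \<longleftrightarrow>
     (\<forall>n. X n \<in> borel_measurable M) \<and> Y \<in> borel_measurable M' \<and>
     (\<forall>f :: 'c \<Rightarrow> real. continuous_on UNIV f \<longrightarrow> bounded (range f) \<longrightarrow>
        (\<lambda>n. \<integral>\<omega>. f (X n \<omega>) \<partial>M) \<longlonglongrightarrow> (\<integral>\<omega>. f (Y \<omega>) \<partial>M'))"

(* Constants count as Gaussian (variance 0); normal_density \<mu> 0 is not a density, so this case
   is listed separately. *)
definition gaussian_rv :: "'a measure \<Rightarrow> ('a \<Rightarrow> real) \<Rightarrow> bool" where
  "gaussian_rv M X \<longleftrightarrow> X \<in> borel_measurable M \<and>
     ((\<exists>\<mu>. AE \<omega> in M. X \<omega> = \<mu>) \<or> (\<exists>\<mu>. \<exists>\<sigma>>0. distributed M lborel X (normal_density \<mu> \<sigma>)))"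

definition gaussian_process :: "'a measure \<Rightarrow> ('t \<Rightarrow> 'a \<Rightarrow> real) \<Rightarrow> bool" where
  "gaussian_process M W \<longleftrightarrow>
     (\<forall>F c. finite F \<longrightarrow> gaussian_rv M (\<lambda>\<omega>. \<Sum>t\<in>F. c t * W t \<omega>))"

definition stationary_process :: "'a measure \<Rightarrow> (real \<Rightarrow> 'a \<Rightarrow> real) \<Rightarrow> bool" where
  "stationary_process M W \<longleftrightarrow>
     (\<forall>F h. finite F \<longrightarrow>
        distr M (Pi\<^sub>M F (\<lambda>_. borel)) (\<lambda>\<omega>. \<lambda>t\<in>F. W (t + h) \<omega>) =
        distr M (Pi\<^sub>M F (\<lambda>_. borel)) (\<lambda>\<omega>. \<lambda>t\<in>F. W t \<omega>))"

definition smooth :: "(real \<Rightarrow> real) \<Rightarrow> bool" where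
  "smooth f \<longleftrightarrow> (\<forall>p. (deriv ^^ p) f differentiable_on UNIV)"

definition trig_poly :: "(nat \<Rightarrow> 'a \<Rightarrow> real) \<Rightarrow> (nat \<Rightarrow> 'a \<Rightarrow> real) \<Rightarrow> nat \<Rightarrow> real \<Rightarrow> 'a \<Rightarrow> real" where
  "trig_poly a b N t \<omega> =
     1 / sqrt (real N) *
       (\<Sum>n=1..N. a n \<omega> * cos (real n * t / real N) + b n \<omega> * sin (real n * t / real N))"

lemma converges_in_distribution_real_iff:
  fixes X :: "nat \<Rightarrow> 'a \<Rightarrow> real" and Y :: "'b \<Rightarrow> real"
  assumes "prob_space M" "prob_space M'"
    and [measurable]: "\<And>n. X n \<in> borel_measurable M" "Y \<in> borel_measurable M'"
  shows "converges_in_distribution M X M' Y \<longleftrightarrow>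
    weak_conv_m (\<lambda>n. distr M borel (X n)) (distr M' borel Y)"
proof
  interpret M: prob_space M by fact
  interpret M': prob_space M' by fact
  have rd: "real_distribution (distr M borel (X n))" "real_distribution (distr M' borel Y)" for n
    by simp_all
  have int_distr: "integral\<^sup>L (distr M borel (X n)) f = (\<integral>\<omega>. f (X n \<omega>) \<partial>M)"
    "integral\<^sup>L (distr M' borel Y) f = (\<integral>\<omega>. f (Y \<omega>) \<partial>M')"
    if "continuous_on UNIV f" for f :: "real \<Rightarrow> real" and n
    using borel_measurable_continuous_onI[OF that] by (simp_all add: integral_distr)
  show "weak_conv_m (\<lambda>n. distr M borel (X n)) (distr M' borel Y)"
    if conv: "converges_in_distribution M X M' Y"
  proof (rule integral_bdd_continuous_conv_imp_weak_conv[OF rd])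
    fix f :: "real \<Rightarrow> real"
    assume f: "\<And>x. isCont f x" "\<And>x. \<bar>f x\<bar> \<le> 1"
    then have "continuous_on UNIV f" "bounded (range f)"
      by (auto simp: continuous_at_imp_continuous_on bounded_iff)
    then show "(\<lambda>n. integral\<^sup>L (distr M borel (X n)) f) \<longlonglongrightarrow> integral\<^sup>L (distr M' borel Y) f"
      using conv by (simp add: int_distr converges_in_distribution_def)
  qed
  show "converges_in_distribution M X M' Y"
    if conv: "weak_conv_m (\<lambda>n. distr M borel (X n)) (distr M' borel Y)"
    unfolding converges_in_distribution_def
  proof (intro conjI allI impI)
    fix f :: "real \<Rightarrow> real"
    assume f: "continuous_on UNIV f" "bounded (range f)"
    then obtain B where "\<And>x. norm (f x) \<le> B" by (auto simp: bounded_iff)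
    moreover have "\<And>x. isCont f x" using f(1) by (simp add: continuous_on_eq_continuous_at)
    ultimately have "(\<lambda>n. integral\<^sup>L (distr M borel (X n)) f) \<longlonglongrightarrow> integral\<^sup>L (distr M' borel Y) f"
      by (intro weak_conv_imp_integral_bdd_continuous_conv[OF rd conv])
    then show "(\<lambda>n. \<integral>\<omega>. f (X n \<omega>) \<partial>M) \<longlonglongrightarrow> (\<integral>\<omega>. f (Y \<omega>) \<partial>M')"
      using f(1) by (simp add: int_distr)
  qed simp_all
qed

end

theory Submission
  imports Defs "HOL-Real_Asymp.Real_Asymp"
begin

text \<open>
  A number of zeros is read off from the signs on a fine grid, and signs on a grid only involve
  finitely many values of the process. The theorem is therefore a consequence of two facts about
  \<open>X\<^sub>N\<close>: its finite-dimensional laws converge to those of \<open>W\<close>, and its second derivative does not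
  blow up on \<open>I\<close>.

  Let \<open>y\<close> be twice differentiable with \<open>\<bar>y''\<bar> \<le> K\<close> on \<open>I\<close>, and let a grid of mesh \<open>\<delta>\<close> be given. If a
  cell contains both a zero and a critical point of \<open>y\<close>, integrating twice gives \<open>\<bar>y\<bar> \<le> K \<delta>\<^sup>2\<close> at its
  left endpoint. So as soon as \<open>\<bar>y\<bar> > K \<delta>\<^sup>2\<close> at all grid points, \<open>y\<close> is strictly monotone on every cell
  that contains a zero, and the zeros are counted exactly by the sign changes on the grid
  (\<open>zeros_eq_sign_changes\<close>).

  For a process whose values are close to standard normal, a given grid point violates
  \<open>\<bar>y\<bar> > K \<delta>\<^sup>2\<close> with probability of order \<open>K \<delta>\<^sup>2\<close>. There are of order \<open>1 / \<delta>\<close> grid points, so the total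
  probability of failure is of order \<open>K \<delta>\<close>, which is small once \<open>K\<close> is fixed and \<open>\<delta>\<close> tends to \<open>0\<close>
  (\<open>gaussian_limit_anticoncentration\<close>, \<open>zeros_approximation\<close>). The same estimate
  holds for \<open>W\<close> itself. So, up to small errors, both zero counts are the same function of
  the sign pattern on one grid.

  Uniformly in \<open>N\<close>, all derivatives of \<open>X\<^sub>N\<close> have second moment at most \<open>1\<close> at every point, since the
  frequencies \<open>n / N\<close> do not exceed \<open>1\<close>. Writing \<open>X\<^sub>N''\<close> as the integral of \<open>X\<^sub>N'''\<close> then bounds the
  supremum of \<open>\<bar>X\<^sub>N''\<bar>\<close> over \<open>I\<close> in probability (\<open>maximal_inequality\<close>), which provides \<open>K\<close>.

  It remains to pass to the limit in the law of the sign pattern on a fixed grid. Characteristic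
  functions of linear combinations of values of \<open>X\<^sub>N\<close> converge by the central limit theorem for
  weighted sums of iid variables (\<open>lindeberg_weighted_sum\<close>), the variance being a Riemann sum for
  the integral of \<open>cos (\<theta> x)\<close> over \<open>[0, 1]\<close>, which is \<open>sin \<theta> / \<theta>\<close>. To go from characteristic
  functions to sign patterns, \<open>x\<close> is replaced by the bounded variable \<open>sin (x / L)\<close>, which has the
  sign of \<open>x\<close> for \<open>\<bar>x\<bar> \<le> L\<close>: polynomials in such variables are linear combinations of characters, and
  by the Weierstrass theorem they approximate every continuous function (\<open>product_convergence\<close>).
\<close>

section \<open>Counting zeros by sign changes\<close>

text \<open>
  A zero and a critical point in the same cell would make \<open>y'\<close> at most \<open>K \<delta>\<close> on the cell and hence
  \<open>y\<close> at most \<open>K \<delta>\<^sup>2\<close> at its endpoints. When the endpoint values are larger, a cell with a zero has no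
  critical point; by Rolle's theorem \<open>y\<close> is then injective on it, hence monotone, so its sign
  changes at its only zero.
\<close>
lemma zeros_on_short_interval:
  fixes y y1 y2 :: "real \<Rightarrow> real"
  assumes der: "\<And>t. (y has_real_derivative y1 t) (at t)" "\<And>t. (y1 has_real_derivative y2 t) (at t)"
    and bound: "\<And>t. t \<in> {p..q} \<Longrightarrow> \<bar>y2 t\<bar> \<le> K"
    and "p \<le> q" "q - p \<le> \<delta>" "0 \<le> K"
    and away: "K * \<delta>\<^sup>2 < \<bar>y p\<bar>" "K * \<delta>\<^sup>2 < \<bar>y q\<bar>"
  shows "finite {z\<in>{p..q}. y z = 0}"
    and "card {z\<in>{p..q}. y z = 0} = (if (0 < y p) \<noteq> (0 < y q) then 1 else 0)"
proof -
  have cont: "continuous_on A y" for A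
    using der(1) by (meson DERIV_continuous_on has_field_derivative_at_within)
  have K\<delta>: "0 \<le> K * \<delta>\<^sup>2" using \<open>0 \<le> K\<close> by simp
  have nz: "y p \<noteq> 0" "y q \<noteq> 0" using away K\<delta> by auto
  have no_crit: "y1 \<tau> \<noteq> 0" if z: "z \<in> {p..q}" "y z = 0" and \<tau>: "\<tau> \<in> {p..q}" for z \<tau>
  proof
    assume "y1 \<tau> = 0"
    have small: "\<bar>y1 x\<bar> \<le> K * \<delta>" if x: "x \<in> {p..q}" for x
    proof -
      have "norm (y1 x - y1 \<tau>) \<le> K * norm (x - \<tau>)"
        by (rule field_differentiable_bound[where S="{p..q}" and f'=y2])
           (use der(2) bound x \<tau> in \<open>auto intro: has_field_derivative_at_within\<close>)
      also have "\<dots> \<le> K * \<delta>"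
        using x \<tau> \<open>q - p \<le> \<delta>\<close> \<open>0 \<le> K\<close> by (intro mult_left_mono) (auto simp: abs_if)
      finally show ?thesis using \<open>y1 \<tau> = 0\<close> by simp
    qed
    have "norm (y p - y z) \<le> (K * \<delta>) * norm (p - z)"
      by (rule field_differentiable_bound[where S="{p..q}" and f'=y1])
         (use der(1) small z \<open>p \<le> q\<close> in \<open>auto intro: has_field_derivative_at_within\<close>)
    also have "\<dots> \<le> (K * \<delta>) * \<delta>"
      using z \<open>q - p \<le> \<delta>\<close> \<open>0 \<le> K\<close> \<open>p \<le> q\<close> by (intro mult_left_mono) (auto simp: abs_if)
    finally show False using away(1) z by (simp add: power2_eq_square mult.assoc)
  qed
  have inj: "inj_on y {p..q}" if z: "z \<in> {p..q}" "y z = 0" for z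
  proof (rule inj_onI, rule ccontr)
    have rolle: False if "u \<in> {p..q}" "v \<in> {p..q}" "y u = y v" "u < v" for u v
    proof -
      obtain l w where w: "u < w" "w < v" "(y has_real_derivative l) (at w)" "y v - y u = (v - u) * l"
        using MVT[OF \<open>u < v\<close> cont] der(1) by (metis real_differentiable_def)
      then have "l = y1 w" using der(1) DERIV_unique by blast
      then show False using w that no_crit[OF z, of w] by auto
    qed
    fix u v assume "u \<in> {p..q}" "v \<in> {p..q}" "y u = y v" "u \<noteq> v"
    then show False using rolle[of u v] rolle[of v u] by (cases "u < v") auto
  qed
  have "{z\<in>{p..q}. y z = 0} = {} \<or> (\<exists>z. {z\<in>{p..q}. y z = 0} = {z})"
    using inj by (auto simp: inj_on_def) (smt (verit) Collect_cong atLeastAtMost_iff singleton_conv)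
  moreover have "(\<exists>z. z \<in> {p..q} \<and> y z = 0) \<longleftrightarrow> (0 < y p) \<noteq> (0 < y q)"
  proof
    assume "\<exists>z. z \<in> {p..q} \<and> y z = 0"
    then obtain z where z: "z \<in> {p..q}" "y z = 0" by blast
    with nz have "p < z" "z < q" by (auto simp: order_less_le)
    then have "(y p < y z \<and> y z < y q) \<or> (y q < y z \<and> y z < y p)"
      using continuous_inj_imp_mono[OF _ _ cont inj[OF z]] by blast
    then show "(0 < y p) \<noteq> (0 < y q)" using z by auto
  next
    assume "(0 < y p) \<noteq> (0 < y q)"
    then consider "y p < 0" "0 < y q" | "y q < 0" "0 < y p" using nz by linarith
    then show "\<exists>z. z \<in> {p..q} \<and> y z = 0"
      using IVT'[of y p 0 q, OF _ _ \<open>p \<le> q\<close> cont] IVT2'[of y q 0 p, OF _ _ \<open>p \<le> q\<close> cont]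
      by cases (force simp: less_imp_le)+
  qed
  ultimately have *: "if (0 < y p) \<noteq> (0 < y q) then (\<exists>z. {z\<in>{p..q}. y z = 0} = {z}) else {z\<in>{p..q}. y z = 0} = {}"
    by auto
  then show "finite {z\<in>{p..q}. y z = 0}"
    by (metis finite.emptyI finite_insert)
  show "card {z\<in>{p..q}. y z = 0} = (if (0 < y p) \<noteq> (0 < y q) then 1 else 0)"
  proof (cases "(0 < y p) \<noteq> (0 < y q)")
    case True
    with * obtain z where "{z\<in>{p..q}. y z = 0} = {z}" by presburger
    then show ?thesis using True by simp
  next
    case False
    with * have "{z\<in>{p..q}. y z = 0} = {}" by presburger
    then have "card {z\<in>{p..q}. y z = 0} = 0" by (simp only: card.empty)
    then show ?thesis using False by presburger
  qed
qed

text \<open>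
  The sign pattern enters only through the set \<open>A\<close> of points where the function is positive. This makes
  the count a function on a finite set of patterns once \<open>t\<close> and \<open>m\<close> are fixed.
\<close>
definition sign_changes :: "(nat \<Rightarrow> real) \<Rightarrow> nat \<Rightarrow> real set \<Rightarrow> nat" where
  "sign_changes t m A = card {j. j < m \<and> (t j \<in> A) \<noteq> (t (Suc j) \<in> A)}"

lemma zeros_eq_sign_changes:
  fixes y y1 y2 :: "real \<Rightarrow> real" and t :: "nat \<Rightarrow> real"
  assumes der: "\<And>s. (y has_real_derivative y1 s) (at s)" "\<And>s. (y1 has_real_derivative y2 s) (at s)"
    and bound: "\<And>s. s \<in> {t 0..t m} \<Longrightarrow> \<bar>y2 s\<bar> \<le> K"
    and grid: "mono t" "\<And>j. t (Suc j) - t j \<le> \<delta>" and "0 < m" "0 \<le> K"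
    and away: "\<And>j. j \<le> m \<Longrightarrow> K * \<delta>\<^sup>2 < \<bar>y (t j)\<bar>"
  shows "zeros y {t 0..t m} = of_nat (sign_changes t m {s. 0 < y s})"
proof -
  define Z where "Z j = {z\<in>{t j..t (Suc j)}. y z = 0}" for j
  have nz: "y (t j) \<noteq> 0" if "j \<le> m" for j
    using away[OF that] mult_nonneg_nonneg[OF \<open>0 \<le> K\<close> zero_le_power2[of \<delta>]] by auto
  have Z: "finite (Z j)" "card (Z j) = (if (0 < y (t j)) \<noteq> (0 < y (t (Suc j))) then 1 else 0)"
    if "j < m" for j
  proof -
    have sub: "{t j..t (Suc j)} \<subseteq> {t 0..t m}"
      using that by (auto intro: order_trans[OF monoD[OF grid(1)]] order_trans[OF _ monoD[OF grid(1)]])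
    then show "finite (Z j)" "card (Z j) = (if (0 < y (t j)) \<noteq> (0 < y (t (Suc j))) then 1 else 0)"
      unfolding Z_def
      using zeros_on_short_interval[OF der, of "t j" "t (Suc j)" K \<delta>] bound
        monoD[OF grid(1), of j "Suc j"] grid(2)[of j] \<open>0 \<le> K\<close> away[of j] away[of "Suc j"] that
      by (auto simp del: One_nat_def)
  qed
  have cover: "{z\<in>{t 0..t m}. y z = 0} = (\<Union>j\<in>{..<m}. Z j)"
  proof (intro equalityI subsetI)
    fix z assume z: "z \<in> {z\<in>{t 0..t m}. y z = 0}"
    \<comment> \<open>The leftmost cell that reaches up to \<open>z\<close>.\<close>
    define j where "j = (LEAST j. z \<le> t (Suc j))"
    have ex: "z \<le> t (Suc (m - 1))" using z \<open>0 < m\<close> by simp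
    have j: "z \<le> t (Suc j)" unfolding j_def by (rule LeastI, rule ex)
    have "j \<le> m - 1" unfolding j_def by (rule Least_le, rule ex)
    moreover have "t j \<le> z"
    proof (cases j)
      case (Suc i)
      then have "\<not> z \<le> t (Suc i)" using not_less_Least[of i "\<lambda>j. z \<le> t (Suc j)"] j_def by simp
      with Suc show ?thesis by simp
    qed (use z in simp)
    ultimately show "z \<in> (\<Union>j\<in>{..<m}. Z j)" using z j \<open>0 < m\<close> by (auto simp: Z_def)
  next
    fix z assume "z \<in> (\<Union>j\<in>{..<m}. Z j)"
    then obtain j where "j < m" "t j \<le> z" "z \<le> t (Suc j)" "y z = 0" by (auto simp: Z_def)
    moreover have "t 0 \<le> t j" "t (Suc j) \<le> t m" using \<open>j < m\<close> by (auto intro: monoD[OF grid(1)])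
    ultimately show "z \<in> {z\<in>{t 0..t m}. y z = 0}" by auto
  qed
  have disj: "Z i \<inter> Z j = {}" if "i < m" "j < m" "i < j" for i j
  proof -
    have "t (Suc i) \<le> t j" using that by (intro monoD[OF grid(1)]) auto
    then have "z = t j" if "z \<in> Z i \<inter> Z j" for z using that by (auto simp: Z_def)
    then show ?thesis using nz[of j] \<open>j < m\<close> by (auto simp: Z_def)
  qed
  have "card (\<Union>j\<in>{..<m}. Z j) = (\<Sum>j<m. card (Z j))"
    using Z disj by (intro card_UN_disjoint) (auto, metis Int_iff empty_iff linorder_less_linear)
  also have "\<dots> = (\<Sum>j<m. if (0 < y (t j)) \<noteq> (0 < y (t (Suc j))) then 1 else 0)"
    using Z by (intro sum.cong) auto
  also have "\<dots> = sign_changes t m {s. 0 < y s}"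
    by (simp add: sign_changes_def sum.If_cases Int_def)
  finally show ?thesis
    using Z(1) unfolding zeros_def cover by simp
qed

section \<open>Measurability of the number of zeros\<close>

text \<open>
  By compactness a continuous path vanishes somewhere on \<open>S\<close> iff it takes arbitrarily small values on a
  countable dense subset of \<open>S\<close>.
\<close>
lemma zero_event_measurable:
  fixes Y :: "real \<Rightarrow> 'a \<Rightarrow> real"
  assumes meas[measurable]: "\<And>t. Y t \<in> borel_measurable M"
    and cont: "\<And>\<omega>. \<omega> \<in> space M \<Longrightarrow> continuous_on UNIV (\<lambda>t. Y t \<omega>)"
    and "compact S"
  shows "{\<omega>\<in>space M. \<exists>t\<in>S. Y t \<omega> = 0} \<in> sets M"
proof -
  obtain D where D: "countable D" "D \<subseteq> S" "S \<subseteq> closure D"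
    using separable by metis
  have "(\<exists>t\<in>S. Y t \<omega> = 0) \<longleftrightarrow> (\<forall>k::nat. \<exists>r\<in>D. \<bar>Y r \<omega>\<bar> < 1 / real (Suc k))"
    if \<omega>: "\<omega> \<in> space M" for \<omega>
  proof
    have cont': "continuous_on A (\<lambda>t. \<bar>Y t \<omega>\<bar>)" for A
      using cont[OF \<omega>] continuous_on_subset by (intro continuous_intros) blast
    {
      assume "\<exists>t\<in>S. Y t \<omega> = 0"
      then obtain t where t: "t \<in> closure D" "Y t \<omega> = 0" using D by blast
      show "\<forall>k::nat. \<exists>r\<in>D. \<bar>Y r \<omega>\<bar> < 1 / real (Suc k)"
      proof (rule allI, rule ccontr)
        fix k assume "\<not> (\<exists>r\<in>D. \<bar>Y r \<omega>\<bar> < 1 / real (Suc k))"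
        then have "\<And>r. r \<in> D \<Longrightarrow> 1 / real (Suc k) \<le> \<bar>Y r \<omega>\<bar>" by force
        then have "1 / real (Suc k) \<le> \<bar>Y t \<omega>\<bar>"
          using continuous_ge_on_closure[OF cont' t(1)] by blast
        then show False using t(2) by (simp add: field_simps)
      qed
    next
      assume small: "\<forall>k::nat. \<exists>r\<in>D. \<bar>Y r \<omega>\<bar> < 1 / real (Suc k)"
      then have "S \<noteq> {}" using D by blast
      then obtain t where t: "t \<in> S" "\<And>s. s \<in> S \<Longrightarrow> \<bar>Y t \<omega>\<bar> \<le> \<bar>Y s \<omega>\<bar>"
        using continuous_attains_inf[OF \<open>compact S\<close> _ cont'] by blast
      have "\<bar>Y t \<omega>\<bar> \<le> 0 + e" if e: "e > 0" for e
      proof -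
        obtain k where "1 / real (Suc k) < e" using e by (rule nat_approx_posE)
        then show ?thesis using small t(2) D(2) by (smt (verit) subsetD)
      qed
      then have "\<bar>Y t \<omega>\<bar> \<le> 0" by (rule field_le_epsilon)
      then show "\<exists>t\<in>S. Y t \<omega> = 0" using t(1) by auto
    }
  qed
  then have "{\<omega>\<in>space M. \<exists>t\<in>S. Y t \<omega> = 0} =
     {\<omega>\<in>space M. \<forall>k::nat. \<exists>r\<in>D. \<bar>Y r \<omega>\<bar> < 1 / real (Suc k)}" by blast
  also have "\<dots> \<in> sets M" using D(1) by measurable
  finally show ?thesis .
qed

lemma sup_bound_event_measurable:
  fixes Y :: "real \<Rightarrow> 'a \<Rightarrow> real"
  assumes meas[measurable]: "\<And>t. Y t \<in> borel_measurable M"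
    and cont: "\<And>\<omega>. \<omega> \<in> space M \<Longrightarrow> continuous_on UNIV (\<lambda>t. Y t \<omega>)"
    and "closed S"
  shows "{\<omega>\<in>space M. \<forall>t\<in>S. \<bar>Y t \<omega>\<bar> \<le> K} \<in> sets M"
proof -
  obtain D where D: "countable D" "D \<subseteq> S" "S \<subseteq> closure D"
    using separable by metis
  have "(\<forall>t\<in>S. \<bar>Y t \<omega>\<bar> \<le> K) \<longleftrightarrow> (\<forall>t\<in>D. \<bar>Y t \<omega>\<bar> \<le> K)" if "\<omega> \<in> space M" for \<omega>
  proof -
    have cont': "continuous_on (closure D) (\<lambda>t. \<bar>Y t \<omega>\<bar>)"
      using cont[OF that] continuous_on_subset by (intro continuous_intros) blast
    show ?thesis
      using D continuous_le_on_closure[OF cont', of _ K] by blast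
  qed
  then have "{\<omega>\<in>space M. \<forall>t\<in>S. \<bar>Y t \<omega>\<bar> \<le> K} = {\<omega>\<in>space M. \<forall>t\<in>D. \<bar>Y t \<omega>\<bar> \<le> K}" by blast
  also have "\<dots> \<in> sets M" using D(1) by measurable
  finally show ?thesis .
qed

lemma finite_real_separated:
  fixes A :: "real set"
  assumes "finite A"
  obtains e where "0 < e" "\<And>x z. x \<in> A \<Longrightarrow> z \<in> A \<Longrightarrow> x \<noteq> z \<Longrightarrow> e < \<bar>x - z\<bar>"
proof -
  \<comment> \<open>Inserting \<open>1\<close> below keeps the minimum defined when there are no two points.\<close>
  let ?D = "(\<lambda>(x, z). \<bar>x - z\<bar>) ` {(x, z) \<in> A \<times> A. x \<noteq> z}"
  have "finite ?D"
    by (intro finite_imageI finite_subset[OF _ finite_cartesian_product[OF assms assms]]) auto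
  then have fin: "finite (insert 1 ?D)" by simp
  show thesis
  proof (rule that)
    show "0 < Min (insert 1 ?D) / 2" using fin by (subst half_gt_zero_iff, subst Min_gr_iff) auto
    then show "Min (insert 1 ?D) / 2 < \<bar>x - z\<bar>" if "x \<in> A" "z \<in> A" "x \<noteq> z" for x z
      using Min_le[OF fin, of "\<bar>x - z\<bar>"] that by force
  qed
qed

text \<open>
  Pairs of rationals serve as names of closed intervals, so that there are only countably many
  finite families of them.
\<close>
definition zero_cells :: "(real \<Rightarrow> real) \<Rightarrow> real set \<Rightarrow> (rat \<times> rat) set \<Rightarrow> (rat \<times> rat) set" where
  "zero_cells y I \<J> = {J\<in>\<J>. \<exists>t\<in>{of_rat (fst J)..of_rat (snd J)} \<inter> I. y t = 0}"

text \<open>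
  Finitely many zeros can be separated by disjoint intervals with rational endpoints, and conversely
  disjoint intervals that each contain a zero contain at least as many zeros. So the
  number of zeros, possibly infinite, is a countable supremum of functions that depend on
  finitely many of the events treated above.
\<close>
lemma zeros_eq_SUP:
  fixes y :: "real \<Rightarrow> real"
  defines "\<F> \<equiv> {\<J>. finite \<J> \<and> disjoint_family_on (\<lambda>J. {of_rat (fst J)..of_rat (snd J) :: real}) \<J>}"
  shows "zeros y I = (SUP \<J>\<in>\<F>. of_nat (card (zero_cells y I \<J>)))"
proof (rule antisym)
  show "(SUP \<J>\<in>\<F>. of_nat (card (zero_cells y I \<J>))) \<le> zeros y I"
  proof (rule SUP_least)
    fix \<J> assume \<J>: "\<J> \<in> \<F>"
    show "of_nat (card (zero_cells y I \<J>)) \<le> zeros y I"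
    proof (cases "finite {t\<in>I. y t = 0}")
      case True
      have "\<forall>J\<in>zero_cells y I \<J>. \<exists>t. t \<in> {of_rat (fst J)..of_rat (snd J)} \<inter> I \<and> y t = 0"
        by (auto simp: zero_cells_def)
      then obtain g where g: "\<And>J. J \<in> zero_cells y I \<J> \<Longrightarrow> g J \<in> {of_rat (fst J)..of_rat (snd J)} \<inter> I \<and> y (g J) = 0"
        by metis
      have "inj_on g (zero_cells y I \<J>)"
      proof (rule inj_onI, rule ccontr)
        fix J J' assume J: "J \<in> zero_cells y I \<J>" "J' \<in> zero_cells y I \<J>" "g J = g J'" "J \<noteq> J'"
        then have "J \<in> \<J>" "J' \<in> \<J>" by (auto simp: zero_cells_def)
        with \<J> J have "{of_rat (fst J)..of_rat (snd J) :: real} \<inter> {of_rat (fst J')..of_rat (snd J')} = {}"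
          by (auto simp: \<F>_def disjoint_family_on_def)
        then show False using g[OF J(1)] g[OF J(2)] J(3) by (metis IntD1 IntI empty_iff)
      qed
      then have "card (zero_cells y I \<J>) \<le> card {t\<in>I. y t = 0}"
        using g True by (intro card_inj_on_le[where f=g]) auto
      then show ?thesis using True by (simp add: zeros_def emeasure_count_space)
    qed (simp add: zeros_def emeasure_count_space)
  qed
next
  have fin: "of_nat (card A) \<le> (SUP \<J>\<in>\<F>. of_nat (card (zero_cells y I \<J>)) :: ennreal)"
    if A: "finite A" "A \<subseteq> {t\<in>I. y t = 0}" for A
  proof -
    obtain e where e: "0 < e" "\<And>x z. x \<in> A \<Longrightarrow> z \<in> A \<Longrightarrow> x \<noteq> z \<Longrightarrow> e < \<bar>x - z\<bar>"
      using finite_real_separated[OF A(1)] by blast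
    have "\<exists>r s::rat. x - e/2 < of_rat r \<and> of_rat r < x \<and> x < of_rat s \<and> of_rat s < x + e/2"
      for x :: real
      using of_rat_dense[of "x - e/2" x] of_rat_dense[of x "x + e/2"] e(1) by auto
    then obtain r s :: "real \<Rightarrow> rat" where rs: "\<And>x. x - e/2 < of_rat (r x)" "\<And>x. of_rat (r x) < x"
        "\<And>x. x < of_rat (s x)" "\<And>x. of_rat (s x) < x + e/2"
      by metis
    define \<J> where "\<J> = (\<lambda>x. (r x, s x)) ` A"
    have inj: "inj_on (\<lambda>x. (r x, s x)) A"
    proof (rule inj_onI, rule ccontr)
      fix x z assume "x \<in> A" "z \<in> A" "(r x, s x) = (r z, s z)" "x \<noteq> z"
      with e(2)[of x z] rs(1,2)[of x] rs(1,2)[of z] rs(3,4)[of x] rs(3,4)[of z] show False by auto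
    qed
    have "\<J> \<in> \<F>"
      unfolding \<F>_def disjoint_family_on_def
    proof (intro CollectI conjI ballI impI)
      show "finite \<J>" using A(1) by (simp add: \<J>_def)
      fix J J' assume "J \<in> \<J>" "J' \<in> \<J>" "J \<noteq> J'"
      then obtain x z where xz: "J = (r x, s x)" "J' = (r z, s z)" "x \<in> A" "z \<in> A" "x \<noteq> z"
        by (auto simp: \<J>_def)
      have False if "w \<in> {of_rat (r x)..of_rat (s x)}" "w \<in> {of_rat (r z)..of_rat (s z)}" for w :: real
        using e(2)[OF xz(3-5)] rs(1,4)[of x] rs(1,4)[of z] that by auto
      then show "{of_rat (fst J)..of_rat (snd J) :: real} \<inter> {of_rat (fst J')..of_rat (snd J')} = {}"
        unfolding xz(1,2) fst_conv snd_conv by blast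
    qed
    moreover have "zero_cells y I \<J> = \<J>"
    proof (intro equalityI subsetI)
      fix J assume J: "J \<in> \<J>"
      then obtain x where x: "J = (r x, s x)" "x \<in> A" by (auto simp: \<J>_def)
      then have "x \<in> {of_rat (fst J)..of_rat (snd J)} \<inter> I" "y x = 0"
        using rs(2,3)[of x] A by auto
      then show "J \<in> zero_cells y I \<J>" using J unfolding zero_cells_def by blast
    qed (simp add: zero_cells_def)
    moreover have "card \<J> = card A" unfolding \<J>_def by (rule card_image[OF inj])
    ultimately show ?thesis by (intro SUP_upper2[of \<J>]) auto
  qed
  show "zeros y I \<le> (SUP \<J>\<in>\<F>. of_nat (card (zero_cells y I \<J>)))"
  proof (cases "finite {t\<in>I. y t = 0}")
    case True
    then show ?thesis using fin[OF True] by (simp add: zeros_def emeasure_count_space)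
  next
    case False
    have "of_nat n \<le> (SUP \<J>\<in>\<F>. of_nat (card (zero_cells y I \<J>)) :: ennreal)" for n
      using infinite_arbitrarily_large[OF False, of n] fin by metis
    then have "(SUP \<J>\<in>\<F>. of_nat (card (zero_cells y I \<J>)) :: ennreal) = top"
      by (metis ennreal_SUP_of_nat_eq_top SUP_least top.extremum_unique)
    then show ?thesis by (simp only: top_greatest)
  qed
qed

lemma zeros_measurable:
  fixes Y :: "real \<Rightarrow> 'a \<Rightarrow> real"
  assumes meas: "\<And>t. Y t \<in> borel_measurable M"
    and cont: "\<And>\<omega>. \<omega> \<in> space M \<Longrightarrow> continuous_on UNIV (\<lambda>t. Y t \<omega>)"
    and "compact I"
  shows "(\<lambda>\<omega>. zeros (\<lambda>t. Y t \<omega>) I) \<in> borel_measurable M"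
  unfolding zeros_eq_SUP
proof (rule borel_measurable_SUP)
  let ?F = "{\<J>. finite \<J> \<and> disjoint_family_on (\<lambda>J. {of_rat (fst J)..of_rat (snd J) :: real}) \<J>}"
  show "countable ?F"
    by (rule countable_subset[OF _ countable_Collect_finite]) auto
  fix \<J> :: "(rat \<times> rat) set" assume "\<J> \<in> ?F"
  then have "finite \<J>" by simp
  have [measurable]: "{\<omega>\<in>space M. \<exists>t\<in>{of_rat (fst J)..of_rat (snd J)} \<inter> I. Y t \<omega> = 0} \<in> sets M" for J :: "rat \<times> rat"
    by (rule zero_event_measurable[OF meas cont]) (simp_all add: closed_Int_compact \<open>compact I\<close>)
  have "of_nat (card (zero_cells (\<lambda>t. Y t \<omega>) I \<J>)) =
     (\<Sum>J\<in>\<J>. indicator {\<omega>\<in>space M. \<exists>t\<in>{of_rat (fst J)..of_rat (snd J)} \<inter> I. Y t \<omega> = 0} \<omega> :: ennreal)"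
    if "\<omega> \<in> space M" for \<omega>
    using \<open>finite \<J>\<close> that by (simp add: zero_cells_def indicator_def sum.If_cases Int_def)
  then show "(\<lambda>\<omega>. of_nat (card (zero_cells (\<lambda>t. Y t \<omega>) I \<J>)) :: ennreal) \<in> borel_measurable M"
    by (subst measurable_cong) (assumption, measurable)
qed

section \<open>Bounded functions of finitely many values\<close>

text \<open>
  Convergence of the characteristic functions of the vectors of values at the points of \<open>F\<close>. The
  goal of the section is to deduce convergence of the expectations of products of bounded functions of the
  single coordinates, which does the work of a Levy continuity theorem in several dimensions.
\<close>
locale fidi_convergence =
  M: prob_space M + M': prob_space M'
  for M :: "'a measure" and M' :: "'b measure" +
  fixes X :: "nat \<Rightarrow> real \<Rightarrow> 'a \<Rightarrow> real" and W :: "real \<Rightarrow> 'b \<Rightarrow> real" and F :: "real set"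
  assumes F: "finite F"
    and X_measurable[measurable]: "\<And>N t. X N t \<in> borel_measurable M"
    and W_measurable[measurable]: "\<And>t. W t \<in> borel_measurable M'"
    and char_conv: "\<And>u. (\<lambda>N. \<integral>\<omega>. iexp (\<Sum>t\<in>F. u t * X N t \<omega>) \<partial>M)
        \<longlonglongrightarrow> (\<integral>\<omega>. iexp (\<Sum>t\<in>F. u t * W t \<omega>) \<partial>M')"
begin

definition test_function :: "((real \<Rightarrow> real) \<Rightarrow> complex) \<Rightarrow> bool" where
  "test_function g \<longleftrightarrow>
     (\<exists>B. \<forall>x. norm (g x) \<le> B) \<and>
     (\<forall>N. (\<lambda>\<omega>. g (\<lambda>t. X N t \<omega>)) \<in> borel_measurable M) \<and>
     (\<lambda>\<omega>. g (\<lambda>t. W t \<omega>)) \<in> borel_measurable M' \<and>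
     (\<lambda>N. \<integral>\<omega>. g (\<lambda>t. X N t \<omega>) \<partial>M) \<longlonglongrightarrow> (\<integral>\<omega>. g (\<lambda>t. W t \<omega>) \<partial>M')"

lemma test_function_integrable:
  assumes "test_function g"
  shows "integrable M (\<lambda>\<omega>. g (\<lambda>t. X N t \<omega>))" "integrable M' (\<lambda>\<omega>. g (\<lambda>t. W t \<omega>))"
proof -
  obtain B where "\<And>x. norm (g x) \<le> B" using assms unfolding test_function_def by blast
  then show "integrable M (\<lambda>\<omega>. g (\<lambda>t. X N t \<omega>))" "integrable M' (\<lambda>\<omega>. g (\<lambda>t. W t \<omega>))"
    using assms unfolding test_function_def
    by (auto intro!: M.integrable_const_bound[where B=B] M'.integrable_const_bound[where B=B])
qed

lemma test_function_measurable:
  assumes "test_function g"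
  shows "(\<lambda>\<omega>. g (\<lambda>t. X N t \<omega>)) \<in> borel_measurable M" "(\<lambda>\<omega>. g (\<lambda>t. W t \<omega>)) \<in> borel_measurable M'"
  using assms by (auto simp: test_function_def)

lemma test_function_add:
  assumes "test_function g" "test_function h"
  shows "test_function (\<lambda>x. g x + h x)"
proof -
  obtain B C where "\<And>x. norm (g x) \<le> B" "\<And>x. norm (h x) \<le> C"
    using assms unfolding test_function_def by blast
  then have "\<And>x. norm (g x + h x) \<le> B + C" by (meson norm_triangle_mono)
  moreover have "(\<lambda>N. \<integral>\<omega>. g (\<lambda>t. X N t \<omega>) + h (\<lambda>t. X N t \<omega>) \<partial>M) \<longlonglongrightarrow>
     (\<integral>\<omega>. g (\<lambda>t. W t \<omega>) + h (\<lambda>t. W t \<omega>) \<partial>M')"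
    using assms test_function_integrable[OF assms(1)] test_function_integrable[OF assms(2)]
    by (simp add: test_function_def tendsto_add)
  ultimately show ?thesis unfolding test_function_def
    by (intro conjI allI exI[of _ "B + C"] borel_measurable_add test_function_measurable assms)
qed

lemma test_function_scale:
  assumes "test_function g"
  shows "test_function (\<lambda>x. k * g x)"
proof -
  obtain B where "\<And>x. norm (g x) \<le> B" using assms unfolding test_function_def by blast
  then have "\<And>x. norm (k * g x) \<le> norm k * B" by (simp add: norm_mult mult_left_mono)
  moreover have "(\<lambda>N. \<integral>\<omega>. k * g (\<lambda>t. X N t \<omega>) \<partial>M) \<longlonglongrightarrow> (\<integral>\<omega>. k * g (\<lambda>t. W t \<omega>) \<partial>M')"
    using assms by (simp add: test_function_def tendsto_mult_left)
  ultimately show ?thesis unfolding test_function_def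
    by (intro conjI allI exI[of _ "norm k * B"] borel_measurable_times borel_measurable_const
        test_function_measurable assms)
qed

lemma test_function_zero: "test_function (\<lambda>x. 0)"
  by (auto simp: test_function_def)

lemma test_function_sum:
  "(\<And>i. i \<in> A \<Longrightarrow> test_function (g i)) \<Longrightarrow> test_function (\<lambda>x. \<Sum>i\<in>A. g i x)"
  by (induction A rule: infinite_finite_induct) (auto simp: test_function_zero test_function_add)

text \<open>
  The class is closed under uniform limits because the laws are probability measures: an error of \<open>e\<close>
  in the function costs at most \<open>e\<close> in both expectations, for all \<open>N\<close> at once.
\<close>
lemma test_function_uniform_limit:
  assumes bounded: "\<And>x. norm (g x) \<le> B"
    and meas: "\<And>N. (\<lambda>\<omega>. g (\<lambda>t. X N t \<omega>)) \<in> borel_measurable M" "(\<lambda>\<omega>. g (\<lambda>t. W t \<omega>)) \<in> borel_measurable M'"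
    and approx: "\<And>e. 0 < e \<Longrightarrow> \<exists>h. test_function h \<and> (\<forall>x. norm (g x - h x) \<le> e)"
  shows "test_function g"
proof -
  have int: "integrable M (\<lambda>\<omega>. g (\<lambda>t. X N t \<omega>))" "integrable M' (\<lambda>\<omega>. g (\<lambda>t. W t \<omega>))" for N
    using bounded meas
    by (auto intro!: M.integrable_const_bound[where B=B] M'.integrable_const_bound[where B=B])
  have "(\<lambda>N. \<integral>\<omega>. g (\<lambda>t. X N t \<omega>) \<partial>M) \<longlonglongrightarrow> (\<integral>\<omega>. g (\<lambda>t. W t \<omega>) \<partial>M')"
  proof (rule LIMSEQ_I)
    fix e :: real assume "0 < e"
    then obtain h where h: "test_function h" "\<And>x. norm (g x - h x) \<le> e/3"
      using approx[of "e/3"] by auto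
    have "(\<lambda>N. \<integral>\<omega>. h (\<lambda>t. X N t \<omega>) \<partial>M) \<longlonglongrightarrow> (\<integral>\<omega>. h (\<lambda>t. W t \<omega>) \<partial>M')"
      using h(1) by (simp add: test_function_def)
    from LIMSEQ_D[OF this, of "e/3"] \<open>0 < e\<close> obtain N0 where
      N0: "\<And>N. N \<ge> N0 \<Longrightarrow> norm ((\<integral>\<omega>. h (\<lambda>t. X N t \<omega>) \<partial>M) - (\<integral>\<omega>. h (\<lambda>t. W t \<omega>) \<partial>M')) < e/3" by auto
    have 1: "norm ((\<integral>\<omega>. g (\<lambda>t. X N t \<omega>) \<partial>M) - (\<integral>\<omega>. h (\<lambda>t. X N t \<omega>) \<partial>M)) \<le> e/3" for N
    proof -
      have "norm (\<integral>\<omega>. g (\<lambda>t. X N t \<omega>) - h (\<lambda>t. X N t \<omega>) \<partial>M) \<le> (\<integral>\<omega>. e/3 \<partial>M)"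
        using h int test_function_integrable[OF h(1)] by (intro order_trans[OF integral_norm_bound integral_mono]) auto
      then show ?thesis using int test_function_integrable[OF h(1)] by (simp add: M.prob_space)
    qed
    have 2: "norm ((\<integral>\<omega>. g (\<lambda>t. W t \<omega>) \<partial>M') - (\<integral>\<omega>. h (\<lambda>t. W t \<omega>) \<partial>M')) \<le> e/3"
    proof -
      have "norm (\<integral>\<omega>. g (\<lambda>t. W t \<omega>) - h (\<lambda>t. W t \<omega>) \<partial>M') \<le> (\<integral>\<omega>. e/3 \<partial>M')"
        using h int test_function_integrable[OF h(1)] by (intro order_trans[OF integral_norm_bound integral_mono]) auto
      then show ?thesis using int test_function_integrable[OF h(1)] by (simp add: M'.prob_space)
    qed
    have tri: "norm (a - d) < e" if "norm (a - b) \<le> e/3" "norm (b - c) < e/3" "norm (d - c) \<le> e/3"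
      for a b c d :: complex
    proof -
      have "norm (a - d) = norm ((a - b) + (b - c) - (d - c))" by (simp add: algebra_simps)
      also have "\<dots> \<le> norm (a - b) + norm (b - c) + norm (d - c)"
        by (meson add_mono norm_triangle_ineq norm_triangle_ineq4 order_refl order_trans)
      finally show ?thesis using that by simp
    qed
    show "\<exists>n0. \<forall>N\<ge>n0. norm ((\<integral>\<omega>. g (\<lambda>t. X N t \<omega>) \<partial>M) - (\<integral>\<omega>. g (\<lambda>t. W t \<omega>) \<partial>M')) < e"
      using tri[OF 1 N0 2] by blast
  qed
  then show ?thesis using bounded meas unfolding test_function_def by blast
qed

lemma test_function_iexp:
  "test_function (\<lambda>x. iexp (\<Sum>t\<in>F. u t * x t))"
proof -
  have "norm (iexp r) \<le> 1" for r :: real by simp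
  then show ?thesis
    unfolding test_function_def using char_conv[of u] by (intro conjI exI[of _ 1] allI) (assumption | (measurable; fail))+
qed

text \<open>
  Products are treated one coordinate at a time. The induction needs a statement that survives
  multiplication by a new factor, and a trigonometric factor just shifts the frequency \<open>u\<close>; hence
  the requirement for all frequencies at once.
\<close>
definition modulable :: "((real \<Rightarrow> real) \<Rightarrow> complex) \<Rightarrow> bool" where
  "modulable g \<longleftrightarrow> (\<forall>u. test_function (\<lambda>x. iexp (\<Sum>t\<in>F. u t * x t) * g x))"

lemma modulable_one: "modulable (\<lambda>x. 1)"
  using test_function_iexp by (simp add: modulable_def)

lemma modulable_add: "modulable g \<Longrightarrow> modulable h \<Longrightarrow> modulable (\<lambda>x. g x + h x)"
  using test_function_add by (auto simp: modulable_def distrib_left)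

lemma modulable_scale: "modulable g \<Longrightarrow> modulable (\<lambda>x. k * g x)"
  using test_function_scale[of _ k] by (auto simp: modulable_def mult.left_commute)

lemma modulable_sum:
  "(\<And>i. i \<in> A \<Longrightarrow> modulable (g i)) \<Longrightarrow> modulable (\<lambda>x. \<Sum>i\<in>A. g i x)"
  using test_function_sum[of A] by (auto simp: modulable_def sum_distrib_left)

lemma modulable_imp_test_function: "modulable g \<Longrightarrow> test_function g"
  unfolding modulable_def by (drule spec[of _ "\<lambda>_. 0"]) simp

lemma modulable_iexp:
  assumes "modulable g" "s \<in> F"
  shows "modulable (\<lambda>x. iexp (k * x s) * g x)"
  unfolding modulable_def
proof
  fix u :: "real \<Rightarrow> real"
  \<comment> \<open>The new factor only adds \<open>k\<close> to the frequency at \<open>s\<close>.\<close>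
  have "(\<Sum>t\<in>F. (u(s := u s + k)) t * x t) = (\<Sum>t\<in>F. u t * x t) + k * x s" for x
  proof -
    have "(\<Sum>t\<in>F. (u(s := u s + k)) t * x t) = (\<Sum>t\<in>F. u t * x t + (if t = s then k * x s else 0))"
      by (intro sum.cong) (auto simp: algebra_simps)
    also have "\<dots> = (\<Sum>t\<in>F. u t * x t) + k * x s"
      using F \<open>s \<in> F\<close> by (simp add: sum.distrib)
    finally show ?thesis .
  qed
  then have *: "iexp (\<Sum>t\<in>F. (u(s := u s + k)) t * x t) * g x = iexp (\<Sum>t\<in>F. u t * x t) * (iexp (k * x s) * g x)" for x
    by (simp add: distrib_left exp_add)
  show "test_function (\<lambda>x. iexp (\<Sum>t\<in>F. u t * x t) * (iexp (k * x s) * g x))"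
    using assms(1)[unfolded modulable_def, rule_format, of "u(s := u s + k)"] unfolding * .
qed

lemma modulable_sin:
  assumes "modulable g" "s \<in> F"
  shows "modulable (\<lambda>x. of_real (sin (k * x s)) * g x)"
proof -
  have "modulable (\<lambda>x. (1 / (2 * \<i>)) * (iexp (k * x s) * g x) + (- 1 / (2 * \<i>)) * (iexp (- k * x s) * g x))"
    by (intro modulable_add modulable_scale modulable_iexp assms)
  moreover have "(1 / (2 * \<i>)) * (iexp (k * x s) * g x) + (- 1 / (2 * \<i>)) * (iexp (- k * x s) * g x)
     = of_real (sin (k * x s)) * g x" for x
    by (simp only: sin_of_real[symmetric] sin_exp_eq) (simp add: field_simps)
  ultimately show ?thesis by simp
qed

text \<open>
  Powers of \<open>sin\<close> are combinations of characters. The bounded variable \<open>sin (k x)\<close> ranges over a compact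
  interval, on which polynomials are uniformly dense in the continuous functions.
\<close>
lemma modulable_continuous_sin:
  assumes g: "modulable g" and "s \<in> F" and r: "continuous_on {-1..1} r"
  shows "modulable (\<lambda>x. of_real (r (sin (k * x s))) * g x)"
  unfolding modulable_def
proof
  fix u :: "real \<Rightarrow> real"
  let ?e = "\<lambda>x. iexp (\<Sum>t\<in>F. u t * x t)"
  have "test_function g" using g by (rule modulable_imp_test_function)
  then obtain B where B: "\<And>x. norm (g x) \<le> B"
    and [measurable]: "\<And>N. (\<lambda>\<omega>. g (\<lambda>t. X N t \<omega>)) \<in> borel_measurable M" "(\<lambda>\<omega>. g (\<lambda>t. W t \<omega>)) \<in> borel_measurable M'"
    unfolding test_function_def by blast
  have "0 \<le> B" using norm_ge_zero B order_trans by blast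
  have poly: "modulable (\<lambda>x. of_real (\<Sum>i\<le>n. a i * sin (k * x s) ^ i) * g x)" for a n
  proof -
    have "modulable (\<lambda>x. of_real (sin (k * x s)) ^ i * g x)" for i
      by (induction i) (use g modulable_sin[OF _ \<open>s \<in> F\<close>] in \<open>auto simp: mult.assoc\<close>)
    then have "modulable (\<lambda>x. \<Sum>i\<le>n. of_real (a i) * (of_real (sin (k * x s)) ^ i * g x))"
      by (intro modulable_sum modulable_scale)
    then show ?thesis by (simp add: sum_distrib_right mult.assoc)
  qed
  obtain R where R: "\<And>v. v \<in> {-1..1} \<Longrightarrow> \<bar>r v\<bar> \<le> R"
    using compact_imp_bounded[OF compact_continuous_image[OF r compact_Icc]] unfolding bounded_iff by (metis image_eqI real_norm_def)
  have "continuous_on UNIV (\<lambda>v. r (max (-1) (min 1 v)))"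
    by (rule continuous_on_compose2[OF r]) (auto intro!: continuous_intros)
  then have [measurable]: "(\<lambda>v. r (max (-1) (min 1 v))) \<in> borel_measurable borel"
    by (rule borel_measurable_continuous_onI)
  have r_eq: "r (sin z) = r (max (-1) (min 1 (sin z)))" for z
    by (simp add: min_absorb2 max_absorb2)
  show "test_function (\<lambda>x. ?e x * (of_real (r (sin (k * x s))) * g x))"
  proof (rule test_function_uniform_limit[where B="R * B"])
    fix x
    show "norm (?e x * (of_real (r (sin (k * x s))) * g x)) \<le> R * B"
      using R[of "sin (k * x s)"] B[of x] by (auto simp: norm_mult intro!: mult_mono)
  next
    fix e :: real assume "0 < e"
    define e' where "e' = e / (B + 1)"
    have "0 < e'" using \<open>0 < e\<close> \<open>0 \<le> B\<close> by (simp add: e'_def)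
    then obtain p where p: "real_polynomial_function p" "\<And>v. v \<in> {-1..1} \<Longrightarrow> \<bar>r v - p v\<bar> < e'"
      using Stone_Weierstrass_real_polynomial_function[OF compact_Icc r] by blast
    obtain a n where an: "p = (\<lambda>v. \<Sum>i\<le>n. a i * v ^ i)"
      using p(1) by (auto simp: real_polynomial_function_iff_sum)
    show "\<exists>h. test_function h \<and> (\<forall>x. norm (?e x * (of_real (r (sin (k * x s))) * g x) - h x) \<le> e)"
    proof (intro exI conjI allI)
      show "test_function (\<lambda>x. ?e x * (of_real (p (sin (k * x s))) * g x))"
        using poly[of a n] unfolding modulable_def an by blast
      fix x
      have "norm (?e x * (of_real (r (sin (k * x s))) * g x) - ?e x * (of_real (p (sin (k * x s))) * g x))
        = \<bar>r (sin (k * x s)) - p (sin (k * x s))\<bar> * norm (g x)"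
        by (simp flip: right_diff_distrib left_diff_distrib of_real_diff add: norm_mult)
      also have "\<dots> \<le> e' * B"
        using p(2)[of "sin (k * x s)"] B[of x] \<open>0 < e'\<close> by (intro mult_mono) auto
      also have "\<dots> \<le> e' * (B + 1)" using \<open>0 < e'\<close> by (intro mult_left_mono) auto
      also have "\<dots> = e" using \<open>0 \<le> B\<close> by (simp add: e'_def)
      finally show "norm (?e x * (of_real (r (sin (k * x s))) * g x) - ?e x * (of_real (p (sin (k * x s))) * g x)) \<le> e" .
    qed
  qed (subst r_eq, measurable)+
qed

lemma product_convergence:
  fixes r :: "real \<Rightarrow> real \<Rightarrow> real"
  assumes "\<And>t. t \<in> F \<Longrightarrow> continuous_on {-1..1} (r t)"
  shows "(\<lambda>N. \<integral>\<omega>. (\<Prod>t\<in>F. r t (sin (k * X N t \<omega>))) \<partial>M)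
      \<longlonglongrightarrow> (\<integral>\<omega>. (\<Prod>t\<in>F. r t (sin (k * W t \<omega>))) \<partial>M')"
proof -
  have "modulable (\<lambda>x. of_real (\<Prod>t\<in>A. r t (sin (k * x t))))" if "finite A" "A \<subseteq> F" for A
    using that
  proof (induction A rule: finite_induct)
    case empty
    then show ?case using modulable_one by simp
  next
    case (insert s A)
    then show ?case
      using modulable_continuous_sin[of _ s "r s" k] assms[of s] by simp
  qed
  from modulable_imp_test_function[OF this[OF F order_refl]]
  show ?thesis unfolding test_function_def integral_complex_of_real by (simp add: tendsto_of_real_iff)
qed

end

section \<open>Central limit theorem for weighted sums\<close>

text \<open>
  The second-order Taylor expansion of a characteristic function with an error \<open>o(t\<^sup>2)\<close>, which under
  a mere second moment comes from dominated convergence, compared with that of \<open>exp (- t\<^sup>2 / 2)\<close>.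
\<close>
lemma (in real_distribution) char_near_gaussian:
  assumes "integrable M (\<lambda>x. x)" "expectation (\<lambda>x. x) = 0"
    and sq: "integrable M (\<lambda>x. x\<^sup>2)" "expectation (\<lambda>x. x\<^sup>2) = 1" and "0 < \<epsilon>"
  shows "\<exists>\<delta>>0. \<forall>t. \<bar>t\<bar> \<le> \<delta> \<longrightarrow> norm (char M t - of_real (exp (- t\<^sup>2 / 2))) \<le> \<epsilon> * t\<^sup>2"
proof -
  define R where "R s = expectation (\<lambda>x. min (6 * x\<^sup>2) (s * \<bar>x\<bar> ^ 3))" for s
  have int: "integrable M (\<lambda>x. min (6 * x\<^sup>2) (s * \<bar>x\<bar> ^ 3))" if "0 \<le> s" for s
    using that by (intro Bochner_Integration.integrable_bound[OF integrable_mult_right[OF sq(1), of 6]]) auto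
  have "(\<lambda>n. min (6 * x\<^sup>2) (inverse (real (Suc n)) * \<bar>x\<bar> ^ 3)) \<longlonglongrightarrow> 0" for x :: real
  proof -
    have "(\<lambda>n. min (6 * x\<^sup>2) (inverse (real (Suc n)) * \<bar>x\<bar> ^ 3)) \<longlonglongrightarrow> min (6 * x\<^sup>2) (0 * \<bar>x\<bar> ^ 3)"
      by (intro tendsto_min tendsto_mult tendsto_const LIMSEQ_inverse_real_of_nat)
    then show ?thesis by simp
  qed
  then have "(\<lambda>n. R (inverse (real (Suc n)))) \<longlonglongrightarrow> expectation (\<lambda>x. 0)"
    unfolding R_def using sq
    by (intro integral_dominated_convergence[where w="\<lambda>x. 6 * x\<^sup>2"]) auto
  then have "(\<lambda>n. R (inverse (real (Suc n)))) \<longlonglongrightarrow> 0" by simp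
  from LIMSEQ_D[OF this \<open>0 < \<epsilon>\<close>] obtain n where n: "\<bar>R (inverse (real (Suc n)))\<bar> < \<epsilon>"
    by (auto dest: spec)
  define \<delta> where "\<delta> = min (inverse (real (Suc n))) (min 1 \<epsilon>)"
  have "0 < \<delta>" using \<open>0 < \<epsilon>\<close> by (simp add: \<delta>_def)
  moreover have "norm (char M t - of_real (exp (- t\<^sup>2 / 2))) \<le> \<epsilon> * t\<^sup>2" if t: "\<bar>t\<bar> \<le> \<delta>" for t
  proof -
    have "norm (char M t - (1 - t\<^sup>2 * 1 / 2)) \<le> t\<^sup>2 / 6 * R \<bar>t\<bar>"
      using char_approx3[of 1 t] assms by (simp add: R_def)
    also have "R \<bar>t\<bar> \<le> R (inverse (real (Suc n)))"
      unfolding R_def using t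
      by (intro integral_mono int min.mono mult_right_mono) (auto simp: \<delta>_def)
    also have "\<dots> \<le> \<epsilon>" using n by simp
    finally have 1: "norm (char M t - of_real (1 - t\<^sup>2 / 2)) \<le> t\<^sup>2 / 6 * \<epsilon>"
      by (simp add: mult_left_mono)
    \<comment> \<open>The bounds \<open>1 - v \<le> exp (- v) \<le> 1 / (1 + v)\<close> suffice for the Gaussian side.\<close>
    define v where "v = t\<^sup>2 / 2"
    have "0 \<le> v" by (simp add: v_def)
    have "1 - v \<le> exp (- v)" using exp_ge_add_one_self[of "- v"] by simp
    moreover have "exp (- v) \<le> 1 - v + v\<^sup>2"
    proof -
      have "exp (- v) \<le> 1 / (1 + v)"
        using exp_ge_add_one_self[of v] \<open>0 \<le> v\<close> by (simp add: exp_minus field_simps)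
      also have "\<dots> \<le> 1 - v + v\<^sup>2"
        using \<open>0 \<le> v\<close> by (simp add: divide_simps) (simp add: algebra_simps power2_eq_square power3_eq_cube)
      finally show ?thesis .
    qed
    ultimately have "\<bar>(1 - v) - exp (- v)\<bar> \<le> v\<^sup>2" by auto
    also have "v\<^sup>2 \<le> t\<^sup>2 / 2 * (\<epsilon> / 2)"
    proof -
      have "t\<^sup>2 = \<bar>t\<bar> * \<bar>t\<bar>" by (simp add: power2_eq_square)
      also have "\<dots> \<le> \<epsilon> * 1" using t \<open>0 < \<epsilon>\<close> by (intro mult_mono) (auto simp: \<delta>_def)
      finally show ?thesis by (simp add: v_def power2_eq_square mult_left_mono)
    qed
    finally have "norm (of_real (1 - t\<^sup>2 / 2) - of_real (exp (- t\<^sup>2 / 2)) :: complex) \<le> t\<^sup>2 / 4 * \<epsilon>"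
      unfolding v_def by (simp only: of_real_diff[symmetric] norm_of_real) simp
    with 1 have "norm (char M t - of_real (exp (- t\<^sup>2 / 2))) \<le> t\<^sup>2 / 6 * \<epsilon> + t\<^sup>2 / 4 * \<epsilon>"
      using dist_triangle[of "char M t" "of_real (exp (- t\<^sup>2 / 2))" "of_real (1 - t\<^sup>2 / 2)"]
      unfolding dist_norm by linarith
    also have "\<dots> = (5 / 12) * (\<epsilon> * t\<^sup>2)" by simp
    also have "\<dots> \<le> \<epsilon> * t\<^sup>2" using \<open>0 < \<epsilon>\<close> mult_nonneg_nonneg[of \<epsilon> "t\<^sup>2"] by simp
    finally show ?thesis .
  qed
  ultimately show ?thesis by blast
qed

text \<open>
  The index type is arbitrary because two families of coefficients will be put into one, indexed by a
  disjoint sum.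
\<close>
locale standardized_iid = prob_space M for M :: "'a measure" +
  fixes \<xi> :: "'i \<Rightarrow> 'a \<Rightarrow> real" and I :: "'i set" and \<mu> :: "real measure"
  assumes indep: "indep_vars (\<lambda>_. borel) \<xi> I"
    and law: "\<And>i. i \<in> I \<Longrightarrow> distr M borel (\<xi> i) = \<mu>"
    and law_sq: "integrable \<mu> (\<lambda>x. x\<^sup>2)" "integral\<^sup>L \<mu> (\<lambda>x. x\<^sup>2) = 1"
    and law_mean: "integral\<^sup>L \<mu> (\<lambda>x. x) = 0"
    and nonempty: "I \<noteq> {}"
begin

lemma \<xi>_measurable: "i \<in> I \<Longrightarrow> \<xi> i \<in> borel_measurable M"
  using indep by (auto simp: indep_vars_def2)

lemma real_distribution_law: "real_distribution \<mu>"
  using nonempty law \<xi>_measurable by (metis ex_in_conv real_distribution_distr)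

lemma \<xi>_moments:
  assumes "i \<in> I"
  shows "integrable M (\<lambda>\<omega>. (\<xi> i \<omega>)\<^sup>2)" "expectation (\<lambda>\<omega>. (\<xi> i \<omega>)\<^sup>2) = 1"
    "integrable M (\<xi> i)" "expectation (\<xi> i) = 0"
proof -
  note [measurable] = \<xi>_measurable[OF assms]
  note L = law[OF assms, symmetric]
  show 1: "integrable M (\<lambda>\<omega>. (\<xi> i \<omega>)\<^sup>2)" using law_sq(1) by (simp add: L integrable_distr_eq)
  show "expectation (\<lambda>\<omega>. (\<xi> i \<omega>)\<^sup>2) = 1" using law_sq(2) by (simp add: L integral_distr)
  show "integrable M (\<xi> i)" by (rule square_integrable_imp_integrable[OF _ 1]) simp
  show "expectation (\<xi> i) = 0" using law_mean by (simp add: L integral_distr)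
qed

lemma \<xi>_orthogonal:
  assumes "i \<in> I" "j \<in> I"
  shows "integrable M (\<lambda>\<omega>. \<xi> i \<omega> * \<xi> j \<omega>)"
    "expectation (\<lambda>\<omega>. \<xi> i \<omega> * \<xi> j \<omega>) = (if i = j then 1 else 0)"
proof -
  have "integrable M (\<lambda>\<omega>. \<xi> i \<omega> * \<xi> j \<omega>) \<and> expectation (\<lambda>\<omega>. \<xi> i \<omega> * \<xi> j \<omega>) = 0" if "i \<noteq> j"
  proof -
    have *: "indep_vars (\<lambda>_. borel) \<xi> {i, j}" by (rule indep_vars_subset[OF indep]) (use assms in auto)
    have "integrable M (\<lambda>\<omega>. \<Prod>k\<in>{i, j}. \<xi> k \<omega>)"
      by (rule indep_vars_integrable) (use * assms \<xi>_moments in auto)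
    moreover have "expectation (\<lambda>\<omega>. \<Prod>k\<in>{i, j}. \<xi> k \<omega>) = (\<Prod>k\<in>{i, j}. expectation (\<xi> k))"
      by (rule indep_vars_lebesgue_integral) (use * assms \<xi>_moments in auto)
    ultimately show ?thesis using that assms \<xi>_moments(4) by simp
  qed
  then show "integrable M (\<lambda>\<omega>. \<xi> i \<omega> * \<xi> j \<omega>)"
    "expectation (\<lambda>\<omega>. \<xi> i \<omega> * \<xi> j \<omega>) = (if i = j then 1 else 0)"
    using \<xi>_moments(1,2)[OF assms(1)] by (cases "i = j"; simp add: power2_eq_square)+
qed

lemma second_moment_weighted_sum:
  assumes "J \<subseteq> I"
  shows "integrable M (\<lambda>\<omega>. (\<Sum>i\<in>J. w i * \<xi> i \<omega>)\<^sup>2)"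
    "expectation (\<lambda>\<omega>. (\<Sum>i\<in>J. w i * \<xi> i \<omega>)\<^sup>2) = (\<Sum>i\<in>J. (w i)\<^sup>2)"
proof -
  have eq: "(\<lambda>\<omega>. (\<Sum>i\<in>J. w i * \<xi> i \<omega>)\<^sup>2) = (\<lambda>\<omega>. \<Sum>i\<in>J. \<Sum>j\<in>J. (w i * w j) * (\<xi> i \<omega> * \<xi> j \<omega>))"
    by (simp add: power2_eq_square sum_product mult_ac)
  show "integrable M (\<lambda>\<omega>. (\<Sum>i\<in>J. w i * \<xi> i \<omega>)\<^sup>2)"
    unfolding eq
    by (intro Bochner_Integration.integrable_sum integrable_mult_right \<xi>_orthogonal(1)) (use assms in auto)
  have "expectation (\<lambda>\<omega>. (\<Sum>i\<in>J. w i * \<xi> i \<omega>)\<^sup>2) =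
      (\<Sum>i\<in>J. \<Sum>j\<in>J. (w i * w j) * expectation (\<lambda>\<omega>. \<xi> i \<omega> * \<xi> j \<omega>))"
  proof -
    have int: "integrable M (\<lambda>\<omega>. (w i * w j) * (\<xi> i \<omega> * \<xi> j \<omega>))" if "i \<in> J" "j \<in> J" for i j
      by (intro integrable_mult_right \<xi>_orthogonal(1)) (use assms that in auto)
    have "expectation (\<lambda>\<omega>. \<Sum>i\<in>J. \<Sum>j\<in>J. (w i * w j) * (\<xi> i \<omega> * \<xi> j \<omega>)) =
      (\<Sum>i\<in>J. expectation (\<lambda>\<omega>. \<Sum>j\<in>J. (w i * w j) * (\<xi> i \<omega> * \<xi> j \<omega>)))"
      by (intro Bochner_Integration.integral_sum Bochner_Integration.integrable_sum int)
    also have "\<dots> = (\<Sum>i\<in>J. \<Sum>j\<in>J. expectation (\<lambda>\<omega>. (w i * w j) * (\<xi> i \<omega> * \<xi> j \<omega>)))"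
      by (intro sum.cong refl Bochner_Integration.integral_sum int)
    finally show ?thesis unfolding eq by simp
  qed
  also have "\<dots> = (\<Sum>i\<in>J. \<Sum>j\<in>J. if i = j then (w i)\<^sup>2 else 0)"
  proof (intro sum.cong refl)
    fix i j assume "i \<in> J" "j \<in> J"
    then have "i \<in> I" "j \<in> I" using assms by blast+
    then show "(w i * w j) * expectation (\<lambda>\<omega>. \<xi> i \<omega> * \<xi> j \<omega>) = (if i = j then (w i)\<^sup>2 else 0)"
      by (subst \<xi>_orthogonal(2)) (simp_all add: power2_eq_square)
  qed
  also have "\<dots> = (\<Sum>i\<in>J. (w i)\<^sup>2)"
    by (cases "finite J") (simp_all add: sum.delta)
  finally show "expectation (\<lambda>\<omega>. (\<Sum>i\<in>J. w i * \<xi> i \<omega>)\<^sup>2) = (\<Sum>i\<in>J. (w i)\<^sup>2)" .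
qed

lemma iexp_weighted_sum:
  assumes "J \<subseteq> I"
  shows "(\<integral>\<omega>. iexp (\<Sum>i\<in>J. w i * \<xi> i \<omega>) \<partial>M) = (\<Prod>i\<in>J. char \<mu> (w i))"
proof -
  have [measurable]: "\<xi> i \<in> borel_measurable M" if "i \<in> J" for i using that assms \<xi>_measurable by auto
  have "indep_vars (\<lambda>_. borel) (\<lambda>i \<omega>. w i * \<xi> i \<omega>) J"
    by (rule indep_vars_compose2[OF indep_vars_subset[OF indep assms]]) simp
  from char_distr_sum[OF this, of 1]
  have "(\<integral>\<omega>. iexp (\<Sum>i\<in>J. w i * \<xi> i \<omega>) \<partial>M) = (\<Prod>i\<in>J. char (distr M borel (\<lambda>\<omega>. w i * \<xi> i \<omega>)) 1)"
    unfolding char_def by (subst (asm) (1) integral_distr) auto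
  also have "\<dots> = (\<Prod>i\<in>J. char \<mu> (w i))"
  proof (intro prod.cong refl)
    fix i assume i: "i \<in> J"
    note [measurable] = \<xi>_measurable[of i]
    show "char (distr M borel (\<lambda>\<omega>. w i * \<xi> i \<omega>)) 1 = char \<mu> (w i)"
      using i assms law[of i, symmetric] by (simp add: char_def integral_distr subset_iff)
  qed
  finally show ?thesis .
qed

text \<open>
  The characteristic function of the sum is a product over the summands. Replacing each factor by the Gaussian one
  costs \<open>\<epsilon> w\<^sub>i\<^sup>2\<close> as soon as all weights are small, and the sum of \<open>w\<^sub>i\<^sup>2\<close> stays bounded.
\<close>
theorem lindeberg_weighted_sum:
  fixes w :: "nat \<Rightarrow> 'i \<Rightarrow> real"
  assumes J: "\<And>n. finite (J n)" "\<And>n. J n \<subseteq> I"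
    and small: "\<And>\<delta>. 0 < \<delta> \<Longrightarrow> \<forall>\<^sub>F n in sequentially. \<forall>i\<in>J n. \<bar>w n i\<bar> \<le> \<delta>"
    and var: "(\<lambda>n. \<Sum>i\<in>J n. (w n i)\<^sup>2) \<longlonglongrightarrow> V"
  shows "(\<lambda>n. \<integral>\<omega>. iexp (\<Sum>i\<in>J n. w n i * \<xi> i \<omega>) \<partial>M) \<longlonglongrightarrow> of_real (exp (- V / 2))"
proof -
  interpret \<mu>: real_distribution \<mu> by (rule real_distribution_law)
  have int1: "integrable \<mu> (\<lambda>x. x)" 
    by (rule \<mu>.square_integrable_imp_integrable[OF _ law_sq(1)]) (simp add: measurable_ident_sets)
  let ?G = "\<lambda>n. \<Prod>i\<in>J n. complex_of_real (exp (- (w n i)\<^sup>2 / 2))"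
  have G: "?G n = of_real (exp (- (\<Sum>i\<in>J n. (w n i)\<^sup>2) / 2))" for n
  proof -
    have "exp (- (\<Sum>i\<in>J n. (w n i)\<^sup>2) / 2) = exp (\<Sum>i\<in>J n. - (w n i)\<^sup>2 / 2)"
      by (simp add: sum_divide_distrib sum_negf)
    then show ?thesis using J(1) by (simp only: exp_sum of_real_prod)
  qed
  have "0 \<le> V" by (rule tendsto_lowerbound[OF var]) (auto intro!: always_eventually sum_nonneg)
  have "(\<lambda>n. (\<Prod>i\<in>J n. char \<mu> (w n i)) - ?G n) \<longlonglongrightarrow> 0"
  proof (rule LIMSEQ_I)
    fix e :: real assume "0 < e"
    \<comment> \<open>The sum of the squared weights is eventually below \<open>V + 1\<close>.\<close>
    define \<epsilon> where "\<epsilon> = e / (V + 1)"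
    have "0 < \<epsilon>" using \<open>0 < e\<close> \<open>0 \<le> V\<close> by (simp add: \<epsilon>_def)
    obtain \<delta> where \<delta>: "0 < \<delta>"
      "\<And>t. \<bar>t\<bar> \<le> \<delta> \<Longrightarrow> norm (char \<mu> t - of_real (exp (- t\<^sup>2 / 2))) \<le> \<epsilon> * t\<^sup>2"
      using \<mu>.char_near_gaussian[OF int1 law_mean law_sq \<open>0 < \<epsilon>\<close>] by metis
    have "\<forall>\<^sub>F n in sequentially. (\<Sum>i\<in>J n. (w n i)\<^sup>2) < V + 1"
      by (rule order_tendstoD(2)[OF var]) simp
    with small[OF \<delta>(1)] have "\<forall>\<^sub>F n in sequentially. norm ((\<Prod>i\<in>J n. char \<mu> (w n i)) - ?G n - 0) < e"
    proof eventually_elim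
      case (elim n)
      have "norm ((\<Prod>i\<in>J n. char \<mu> (w n i)) - ?G n)
        \<le> (\<Sum>i\<in>J n. norm (char \<mu> (w n i) - of_real (exp (- (w n i)\<^sup>2 / 2))))"
        by (rule norm_prod_diff) (auto simp: \<mu>.cmod_char_le_1)
      also have "\<dots> \<le> (\<Sum>i\<in>J n. \<epsilon> * (w n i)\<^sup>2)"
        using \<delta>(2) elim(1) by (intro sum_mono) auto
      also have "\<dots> = \<epsilon> * (\<Sum>i\<in>J n. (w n i)\<^sup>2)" by (simp add: sum_distrib_left)
      also have "\<dots> < \<epsilon> * (V + 1)" using elim(2) \<open>0 < \<epsilon>\<close> by (intro mult_strict_left_mono) auto
      also have "\<dots> = e" using \<open>0 \<le> V\<close> by (simp add: \<epsilon>_def)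
      finally show ?case by simp
    qed
    then show "\<exists>n0. \<forall>n\<ge>n0. norm ((\<Prod>i\<in>J n. char \<mu> (w n i)) - ?G n - 0) < e"
      unfolding eventually_sequentially .
  qed
  moreover have "?G \<longlonglongrightarrow> of_real (exp (- V / 2))"
    unfolding G by (intro tendsto_of_real tendsto_exp tendsto_divide tendsto_minus tendsto_const var) simp
  ultimately have "(\<lambda>n. (\<Prod>i\<in>J n. char \<mu> (w n i)) - ?G n + ?G n) \<longlonglongrightarrow> 0 + of_real (exp (- V / 2))"
    by (rule tendsto_add)
  then show ?thesis unfolding iexp_weighted_sum[OF J(2)] diff_add_cancel add_0_left .
qed

end

section \<open>Characteristic functions of Gaussian processes\<close>

lemma (in prob_space) gaussian_rv_square_integrable:
  assumes "gaussian_rv M X"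
  shows "integrable M (\<lambda>\<omega>. (X \<omega>)\<^sup>2)"
proof -
  have [measurable]: "X \<in> borel_measurable M" using assms by (simp add: gaussian_rv_def)
  consider m where "AE \<omega> in M. X \<omega> = m" | m s where "0 < s" "distributed M lborel X (normal_density m s)"
    using assms by (auto simp: gaussian_rv_def)
  then show ?thesis
  proof cases
    case 1
    then have "integrable M (\<lambda>\<omega>. (X \<omega>)\<^sup>2) \<longleftrightarrow> integrable M (\<lambda>\<omega>. m\<^sup>2)"
      by (intro integrable_cong_AE) auto
    then show ?thesis by simp
  next
    case 2
    have "integrable lborel (\<lambda>x. normal_density m s x * ((x - m)\<^sup>2 + 2 * m * x - m\<^sup>2))"
      using integrable_normal_moment[OF 2(1), of m 2] integrable_normal_moment_nz_1[OF 2(1), of m] 2(1)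
      by (simp add: distrib_left right_diff_distrib mult.left_commute[of _ "2 * m"] mult.commute[of _ "m\<^sup>2"])
    then have "integrable lborel (\<lambda>x. normal_density m s x * x\<^sup>2)"
      by (simp add: power2_eq_square algebra_simps)
    then show ?thesis
      using distributed_integrable[OF 2(2), of "\<lambda>x. x\<^sup>2"] by simp
  qed
qed

lemma (in prob_space) gaussian_rv_iexp:
  assumes X: "gaussian_rv M X" and "expectation X = 0"
  shows "(\<integral>\<omega>. iexp (X \<omega>) \<partial>M) = of_real (exp (- expectation (\<lambda>\<omega>. (X \<omega>)\<^sup>2) / 2))"
proof -
  have [measurable]: "X \<in> borel_measurable M" using assms by (simp add: gaussian_rv_def)
  consider m where "AE \<omega> in M. X \<omega> = m" | m s where "0 < s" "distributed M lborel X (normal_density m s)"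
    using assms by (auto simp: gaussian_rv_def)
  then show ?thesis
  proof cases
    case 1
    then have "expectation X = expectation (\<lambda>\<omega>. m)" by (intro integral_cong_AE) auto
    then have "m = 0" using assms(2) by (simp add: prob_space)
    have "expectation (\<lambda>\<omega>. (X \<omega>)\<^sup>2) = expectation (\<lambda>\<omega>. 0)"
      "(\<integral>\<omega>. iexp (X \<omega>) \<partial>M) = (\<integral>\<omega>. 1 \<partial>M)" using 1 \<open>m = 0\<close> by (intro integral_cong_AE; force)+
    then show ?thesis by (simp add: prob_space)
  next
    case 2
    have "m = 0" using normal_distributed_expectation[OF 2] assms(2) by simp
    have var: "expectation (\<lambda>\<omega>. (X \<omega>)\<^sup>2) = s\<^sup>2"
      using normal_distributed_variance[OF 2] assms(2) by simp
    have "distributed M lborel (\<lambda>x. X x / s) std_normal_density"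
      using normal_standard_normal_convert[OF 2(1), of X m] 2 \<open>m = 0\<close> by simp
    then have "distr M lborel (\<lambda>x. X x / s) = std_normal_distribution" by (simp add: distributed_def)
    then have "distr M borel (\<lambda>x. X x / s) = std_normal_distribution"
      by (metis distr_cong sets_lborel)
    then have "char (distr M borel (\<lambda>x. X x / s)) s = char std_normal_distribution s" by simp
    moreover have "char (distr M borel (\<lambda>x. X x / s)) s = (\<integral>\<omega>. iexp (s * (X \<omega> / s)) \<partial>M)"
      unfolding char_def using \<open>0 < s\<close> by (simp add: integral_distr)
    ultimately show ?thesis using \<open>0 < s\<close> var by (simp add: char_std_normal_distribution)
  qed
qed

lemma (in prob_space) gaussian_process_iexp:
  assumes W: "gaussian_process M W" and mean: "\<And>t. expectation (W t) = 0"
    and cov: "\<And>s t. expectation (\<lambda>\<omega>. W s \<omega> * W t \<omega>) = r s t" and "finite F"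
  shows "(\<integral>\<omega>. iexp (\<Sum>t\<in>F. u t * W t \<omega>) \<partial>M) =
    of_real (exp (- (\<Sum>s\<in>F. \<Sum>t\<in>F. u s * u t * r s t) / 2))"
proof -
  have W_rv: "gaussian_rv M (W t)" for t
    using W[unfolded gaussian_process_def, rule_format, of "{t}" "\<lambda>_. 1"] by simp
  then have [measurable]: "W t \<in> borel_measurable M" for t by (simp add: gaussian_rv_def)
  have sq: "integrable M (\<lambda>\<omega>. (W t \<omega>)\<^sup>2)" for t by (rule gaussian_rv_square_integrable[OF W_rv])
  have int: "integrable M (W t)" for t by (rule square_integrable_imp_integrable[OF _ sq]) simp
  have int2: "integrable M (\<lambda>\<omega>. W s \<omega> * W t \<omega>)" for s t
  proof (rule Bochner_Integration.integrable_bound)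
    show "integrable M (\<lambda>\<omega>. (W s \<omega>)\<^sup>2 + (W t \<omega>)\<^sup>2)" using sq by simp
    have "\<bar>x * y\<bar> \<le> x\<^sup>2 + y\<^sup>2" for x y :: real
    proof -
      have "2 * \<bar>x * y\<bar> \<le> x\<^sup>2 + y\<^sup>2"
        using sum_squares_bound[of "\<bar>x\<bar>" "\<bar>y\<bar>"] by (simp add: abs_mult)
      then show ?thesis using zero_le_power2[of x] zero_le_power2[of y] by linarith
    qed
    then show "AE \<omega> in M. norm (W s \<omega> * W t \<omega>) \<le> norm ((W s \<omega>)\<^sup>2 + (W t \<omega>)\<^sup>2)" by simp
  qed simp
  let ?S = "\<lambda>\<omega>. \<Sum>t\<in>F. u t * W t \<omega>"
  have "gaussian_rv M ?S" using W \<open>finite F\<close> by (simp add: gaussian_process_def)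
  moreover have "expectation ?S = 0" using int mean by simp
  ultimately have "(\<integral>\<omega>. iexp (?S \<omega>) \<partial>M) = of_real (exp (- expectation (\<lambda>\<omega>. (?S \<omega>)\<^sup>2) / 2))"
    by (rule gaussian_rv_iexp)
  also have "(\<lambda>\<omega>. (?S \<omega>)\<^sup>2) = (\<lambda>\<omega>. \<Sum>s\<in>F. \<Sum>t\<in>F. (u s * u t) * (W s \<omega> * W t \<omega>))"
    by (simp add: power2_eq_square sum_product mult_ac)
  also have "expectation \<dots> = (\<Sum>s\<in>F. \<Sum>t\<in>F. u s * u t * r s t)"
  proof -
    have "expectation (\<lambda>\<omega>. \<Sum>s\<in>F. \<Sum>t\<in>F. (u s * u t) * (W s \<omega> * W t \<omega>)) =
      (\<Sum>s\<in>F. expectation (\<lambda>\<omega>. \<Sum>t\<in>F. (u s * u t) * (W s \<omega> * W t \<omega>)))"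
      by (intro Bochner_Integration.integral_sum Bochner_Integration.integrable_sum integrable_mult_right int2)
    also have "\<dots> = (\<Sum>s\<in>F. \<Sum>t\<in>F. expectation (\<lambda>\<omega>. (u s * u t) * (W s \<omega> * W t \<omega>)))"
      by (intro sum.cong refl Bochner_Integration.integral_sum integrable_mult_right int2)
    finally show ?thesis by (simp add: cov)
  qed
  finally show ?thesis .
qed

section \<open>Convergence of zero counts for twice differentiable processes\<close>

text \<open>
  By the continuity theorem the distribution functions converge to the normal one, whose density is at
  most \<open>1\<close>. The half-open interval \<open>(- 2 \<kappa>, \<kappa>]\<close> contains \<open>[- \<kappa>, \<kappa>]\<close> and is a difference of
  distribution functions; its normal probability is at most \<open>3 \<kappa>\<close>, and \<open>4 \<kappa>\<close> leaves
  room for the convergence.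
\<close>
lemma gaussian_limit_anticoncentration:
  assumes "prob_space M" and meas[measurable]: "\<And>N. X N \<in> borel_measurable M"
    and conv: "\<And>u. (\<lambda>N. \<integral>\<omega>. iexp (u * X N \<omega>) \<partial>M) \<longlonglongrightarrow> of_real (exp (- u\<^sup>2 / 2))"
    and "0 < \<kappa>"
  shows "\<forall>\<^sub>F N in sequentially. measure M {\<omega>\<in>space M. \<bar>X N \<omega>\<bar> \<le> \<kappa>} \<le> 4 * \<kappa>"
proof -
  interpret prob_space M by fact
  let ?D = "\<lambda>N. distr M borel (X N)"
  have rd: "real_distribution (?D N)" for N by simp
  interpret S: real_distribution std_normal_distribution by (rule real_dist_normal_dist)
  have weak: "weak_conv_m ?D std_normal_distribution"
  proof (rule levy_continuity[OF rd real_dist_normal_dist])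
    show "(\<lambda>N. char (?D N) u) \<longlonglongrightarrow> char std_normal_distribution u" for u
      using conv[of u] unfolding char_std_normal_distribution by (simp add: char_def integral_distr)
  qed
  have no_atom: "measure std_normal_distribution {x} = 0" for x
    by (simp add: measure_def emeasure_density nn_integral_cmult_indicator[symmetric] nn_integral_0_iff_AE AE_lborel_singleton)
  then have "isCont (cdf std_normal_distribution) x" for x
    by (simp add: S.isCont_cdf)
  then have cdf: "(\<lambda>N. cdf (?D N) x) \<longlonglongrightarrow> cdf std_normal_distribution x" for x
    using weak by (simp add: weak_conv_m_def weak_conv_def)
  have density: "cdf std_normal_distribution \<kappa> - cdf std_normal_distribution (- (2 * \<kappa>)) \<le> 3 * \<kappa>"
  proof -
    have "cdf std_normal_distribution \<kappa> - cdf std_normal_distribution (- (2 * \<kappa>)) =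
        measure std_normal_distribution {- (2 * \<kappa>)<..\<kappa>}"
      using \<open>0 < \<kappa>\<close> by (intro S.cdf_diff_eq) simp
    also have "\<dots> \<le> 3 * \<kappa>"
    proof -
      have "std_normal_density x \<le> 1" for x
      proof -
        have "1 \<le> sqrt (2 * pi)" using pi_ge_two by (simp add: real_le_rsqrt)
        then have "1 / sqrt (2 * pi) * exp (- x\<^sup>2 / 2) \<le> 1 * 1" by (intro mult_mono) (simp_all add: divide_le_eq)
        then show ?thesis by (simp add: std_normal_density_def)
      qed
      then have le: "ennreal (std_normal_density x) \<le> 1" for x
        using ennreal_leI[of "std_normal_density x" 1] by simp
      have "emeasure std_normal_distribution {- (2 * \<kappa>)<..\<kappa>} \<le> (\<integral>\<^sup>+x. indicator {- (2 * \<kappa>)<..\<kappa>} x \<partial>lborel)"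
        by (subst emeasure_density) (auto intro!: nn_integral_mono simp del: nn_integral_indicator simp: indicator_def intro: le[simplified])
      also have "\<dots> = ennreal (3 * \<kappa>)" using \<open>0 < \<kappa>\<close> by simp
      finally show ?thesis using \<open>0 < \<kappa>\<close> by (simp add: S.emeasure_eq_measure)
    qed
    finally show ?thesis .
  qed
  have "(\<lambda>N. cdf (?D N) \<kappa> - cdf (?D N) (- (2 * \<kappa>))) \<longlonglongrightarrow>
      cdf std_normal_distribution \<kappa> - cdf std_normal_distribution (- (2 * \<kappa>))"
    by (intro tendsto_diff cdf)
  then have "\<forall>\<^sub>F N in sequentially. cdf (?D N) \<kappa> - cdf (?D N) (- (2 * \<kappa>)) < 4 * \<kappa>"
    using density \<open>0 < \<kappa>\<close> by (intro order_tendstoD(2)) auto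
  then show ?thesis
  proof eventually_elim
    case (elim N)
    interpret D: real_distribution "?D N" by simp
    have "cdf (?D N) \<kappa> - cdf (?D N) (- (2 * \<kappa>)) = measure (?D N) {- (2 * \<kappa>)<..\<kappa>}"
      using \<open>0 < \<kappa>\<close> by (intro D.cdf_diff_eq) simp
    also have "\<dots> = measure M {\<omega>\<in>space M. - (2 * \<kappa>) < X N \<omega> \<and> X N \<omega> \<le> \<kappa>}"
      by (simp add: measure_distr vimage_def Int_def conj_commute)
    moreover have "measure M {\<omega>\<in>space M. \<bar>X N \<omega>\<bar> \<le> \<kappa>} \<le>
        measure M {\<omega>\<in>space M. - (2 * \<kappa>) < X N \<omega> \<and> X N \<omega> \<le> \<kappa>}"
      using \<open>0 < \<kappa>\<close> by (intro finite_measure_mono) auto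
    ultimately show ?case using elim by simp
  qed
qed

text \<open>
  A continuous substitute for the indicator of the positive reals, exact outside \<open>(- \<eta>, \<eta>)\<close>.
\<close>
definition ramp :: "real \<Rightarrow> real \<Rightarrow> real" where
  "ramp \<eta> v = max 0 (min 1 ((v / \<eta> + 1) / 2))"

lemma ramp_range: "0 \<le> ramp \<eta> v" "ramp \<eta> v \<le> 1"
  by (auto simp: ramp_def)

lemma continuous_on_ramp[continuous_intros]: "continuous_on A (ramp \<eta>)"
  unfolding ramp_def divide_inverse by (intro continuous_intros)

lemma ramp_sin:
  assumes "0 < \<kappa>" "\<kappa> < \<bar>x\<bar>" "\<bar>x\<bar> \<le> L"
  shows "ramp (sin (\<kappa> / L)) (sin (x / L)) = (if 0 < x then 1 else 0)"
proof -
  define u v where "u = \<kappa> / L" and "v = \<bar>x\<bar> / L"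
  have "0 < L" using assms by linarith
  then have uv: "0 < u" "u \<le> v" "v \<le> 1"
    using assms by (simp_all add: u_def v_def divide_right_mono)
  have "sin u \<le> sin v"
    by (rule sin_monotone_2pi_le) (use uv pi_ge_two in linarith)+
  moreover have "0 < sin u"
    by (rule sin_gt_zero) (use uv pi_ge_two in linarith)+
  ultimately have q: "1 \<le> sin v / sin u" by simp
  have sign: "sin (x / L) = (if 0 < x then sin v else - sin v)"
    by (cases "0 < x") (simp_all add: v_def)
  have "max 0 (min 1 ((w + 1) / 2)) = 1" "max 0 (min 1 ((- w + 1) / 2)) = 0" if "1 \<le> w" for w :: real
    using that by (simp_all add: min_def max_def)
  from this[OF q] show ?thesis
    unfolding ramp_def u_def[symmetric] sign by simp
qed

text \<open>
  A multilinear interpolation of \<open>g\<close>: each point \<open>s\<close> belongs to the random set independently with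
  probability \<open>ramp \<eta> (sin (y s / L))\<close>, and \<open>g\<close> is averaged over that set. So the bounds of \<open>g\<close> persist,
  whatever the number of points is, and the result is a finite sum of products of functions of
  the single coordinates.
\<close>
definition sign_pattern_average :: "(real set \<Rightarrow> real) \<Rightarrow> real set \<Rightarrow> real \<Rightarrow> real \<Rightarrow> (real \<Rightarrow> real) \<Rightarrow> real" where
  "sign_pattern_average g T \<eta> L y =
     (\<Sum>A\<in>Pow T. g A * (\<Prod>s\<in>T. if s \<in> A then ramp \<eta> (sin (y s / L)) else 1 - ramp \<eta> (sin (y s / L))))"

text \<open>
  The weights of the patterns are nonnegative and add up to \<open>1\<close>, by expanding
  \<open>\<Prod>s\<in>T. p s + (1 - p s)\<close>.
\<close>
lemma abs_sign_pattern_average_le: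
  assumes "finite T" "\<And>A. \<bar>g A\<bar> \<le> B"
  shows "\<bar>sign_pattern_average g T \<eta> L y\<bar> \<le> B"
proof -
  let ?p = "\<lambda>s. ramp \<eta> (sin (y s / L))"
  let ?w = "\<lambda>A. \<Prod>s\<in>T. if s \<in> A then ?p s else 1 - ?p s"
  have w: "0 \<le> ?w A" for A by (intro prod_nonneg) (auto simp: ramp_range)
  have "(\<Sum>A\<in>Pow T. ?w A) = (\<Sum>A\<in>Pow T. (\<Prod>s\<in>A. ?p s) * (\<Prod>s\<in>T - A. 1 - ?p s))"
  proof (intro sum.cong refl)
    fix A assume "A \<in> Pow T"
    then show "?w A = (\<Prod>s\<in>A. ?p s) * (\<Prod>s\<in>T - A. 1 - ?p s)"
      using \<open>finite T\<close> by (subst prod.If_cases) (auto simp: Int_absorb1 Diff_eq[symmetric] Int_def intro!: arg_cong2[where f="(*)"] prod.cong)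
  qed
  also have "\<dots> = (\<Prod>s\<in>T. ?p s + (1 - ?p s))" by (rule prod_add[OF \<open>finite T\<close>, symmetric])
  finally have total: "(\<Sum>A\<in>Pow T. ?w A) = 1" by simp
  have "\<bar>sign_pattern_average g T \<eta> L y\<bar> \<le> (\<Sum>A\<in>Pow T. \<bar>g A\<bar> * ?w A)"
    unfolding sign_pattern_average_def
    by (rule order_trans[OF sum_abs]) (simp add: abs_mult abs_of_nonneg[OF w])
  also have "\<dots> \<le> (\<Sum>A\<in>Pow T. B * ?w A)"
    by (intro sum_mono mult_right_mono assms w)
  also have "\<dots> = B" by (simp add: sum_distrib_left[symmetric] total)
  finally show ?thesis .
qed

lemma sign_pattern_average_eq:
  assumes "finite T" "0 < \<kappa>" "\<And>s. s \<in> T \<Longrightarrow> \<kappa> < \<bar>y s\<bar>" "\<And>s. s \<in> T \<Longrightarrow> \<bar>y s\<bar> \<le> L"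
  shows "sign_pattern_average g T (sin (\<kappa> / L)) L y = g {s\<in>T. 0 < y s}"
proof -
  have "(\<Prod>s\<in>T. if s \<in> A then ramp (sin (\<kappa> / L)) (sin (y s / L)) else 1 - ramp (sin (\<kappa> / L)) (sin (y s / L)))
     = (if A = {s\<in>T. 0 < y s} then 1 else 0)" if "A \<in> Pow T" for A
  proof -
    have *: "(if s \<in> A then ramp (sin (\<kappa> / L)) (sin (y s / L)) else 1 - ramp (sin (\<kappa> / L)) (sin (y s / L)))
      = (if s \<in> A \<longleftrightarrow> 0 < y s then 1 else 0)" if "s \<in> T" for s
      using ramp_sin[OF assms(2) assms(3,4)[OF that]] by simp
    have "(A = {s\<in>T. 0 < y s}) \<longleftrightarrow> (\<forall>s\<in>T. s \<in> A \<longleftrightarrow> 0 < y s)" using that by blast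
    then show ?thesis using \<open>finite T\<close> by (auto simp: * intro!: prod_zero cong: prod.cong)
  qed
  then have "sign_pattern_average g T (sin (\<kappa> / L)) L y = (\<Sum>A\<in>Pow T. if A = {s\<in>T. 0 < y s} then g A else 0)"
    unfolding sign_pattern_average_def by (intro sum.cong) auto
  also have "\<dots> = g {s\<in>T. 0 < y s}"
    using \<open>finite T\<close> by (subst sum.delta) auto
  finally show ?thesis .
qed

lemma (in fidi_convergence) sign_pattern_average_convergence:
  "(\<lambda>N. \<integral>\<omega>. sign_pattern_average g F \<eta> L (\<lambda>t. X N t \<omega>) \<partial>M) \<longlonglongrightarrow>
    (\<integral>\<omega>. sign_pattern_average g F \<eta> L (\<lambda>t. W t \<omega>) \<partial>M')"
proof -
  define r where "r A s v = (if s \<in> A then ramp \<eta> v else 1 - ramp \<eta> v)" for A :: "real set" and s v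
  have cont: "continuous_on B (r A s)" for A B s unfolding r_def by (cases "s \<in> A") (auto intro!: continuous_intros)
  then have [measurable]: "r A s \<in> borel_measurable borel" for A s by (intro borel_measurable_continuous_onI)
  have bound: "\<bar>\<Prod>s\<in>F. r A s (sin (1 / L * z s))\<bar> \<le> 1" for A z
    unfolding abs_prod by (intro prod_le_1) (auto simp: r_def ramp_range)
  have int: "integrable M (\<lambda>\<omega>. \<Prod>s\<in>F. r A s (sin (1 / L * X N s \<omega>)))"
     "integrable M' (\<lambda>\<omega>. \<Prod>s\<in>F. r A s (sin (1 / L * W s \<omega>)))" for A N
    using bound by (auto intro!: M.integrable_const_bound[where B=1] M'.integrable_const_bound[where B=1])
  have eq: "sign_pattern_average g F \<eta> L y = (\<Sum>A\<in>Pow F. g A * (\<Prod>s\<in>F. r A s (sin (1 / L * y s))))" for y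
    by (simp add: sign_pattern_average_def r_def)
  have "(\<integral>\<omega>. sign_pattern_average g F \<eta> L (\<lambda>t. X N t \<omega>) \<partial>M) =
      (\<Sum>A\<in>Pow F. g A * (\<integral>\<omega>. (\<Prod>s\<in>F. r A s (sin (1 / L * X N s \<omega>))) \<partial>M))" for N
    unfolding eq
    by (simp only: Bochner_Integration.integral_sum[OF integrable_mult_right[OF int(1)]] integral_mult_right_zero)
  moreover have "(\<integral>\<omega>. sign_pattern_average g F \<eta> L (\<lambda>t. W t \<omega>) \<partial>M') =
      (\<Sum>A\<in>Pow F. g A * (\<integral>\<omega>. (\<Prod>s\<in>F. r A s (sin (1 / L * W s \<omega>))) \<partial>M'))"
    unfolding eq
    by (simp only: Bochner_Integration.integral_sum[OF integrable_mult_right[OF int(2)]] integral_mult_right_zero)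
  ultimately show ?thesis
    by (simp only: ) (rule tendsto_sum, rule tendsto_mult_left, rule product_convergence, rule cont)
qed

lemma sign_changes_restrict:
  "sign_changes t m {s\<in>t ` {..m}. 0 < y s} = sign_changes t m {s. 0 < y s}"
  unfolding sign_changes_def by (intro arg_cong[where f=card]) auto

text \<open>
  The derivatives are parameters of the locale, so that it applies to explicit formulas for them as well as to
  \<^const>\<open>deriv\<close> of the paths.
\<close>
locale C2_process = prob_space M for M :: "'a measure" +
  fixes Y Y1 Y2 :: "real \<Rightarrow> 'a \<Rightarrow> real"
  assumes Y_measurable[measurable]: "\<And>t. Y t \<in> borel_measurable M"
    and Y2_measurable: "\<And>t. Y2 t \<in> borel_measurable M"
    and deriv: "\<And>\<omega> t. \<omega> \<in> space M \<Longrightarrow> ((\<lambda>t. Y t \<omega>) has_real_derivative Y1 t \<omega>) (at t)"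
      "\<And>\<omega> t. \<omega> \<in> space M \<Longrightarrow> ((\<lambda>t. Y1 t \<omega>) has_real_derivative Y2 t \<omega>) (at t)"
    and Y2_continuous: "\<And>\<omega>. \<omega> \<in> space M \<Longrightarrow> continuous_on UNIV (\<lambda>t. Y2 t \<omega>)"
begin

lemma Y_continuous: "\<omega> \<in> space M \<Longrightarrow> continuous_on UNIV (\<lambda>t. Y t \<omega>)"
  by (rule DERIV_continuous_on, rule has_field_derivative_at_within, rule deriv(1))

lemma zero_count_measurable: "(\<lambda>\<omega>. zeros (\<lambda>t. Y t \<omega>) {c..d}) \<in> borel_measurable M"
  by (rule zeros_measurable[OF Y_measurable Y_continuous compact_Icc])

lemma curvature_event: "{\<omega>\<in>space M. \<forall>t\<in>{c..d}. \<bar>Y2 t \<omega>\<bar> \<le> K} \<in> sets M"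
  by (rule sup_bound_event_measurable[OF Y2_measurable Y2_continuous closed_atLeastAtMost])

text \<open>
  Both integrands are bounded by \<open>B\<close> and agree where the second derivative is at most \<open>K\<close> and the values on
  the grid lie between \<open>\<kappa>\<close> and \<open>L\<close> in absolute value. The complement is estimated by a union bound.
\<close>
lemma zeros_vs_sign_changes:
  fixes f :: "ennreal \<Rightarrow> real" and t :: "nat \<Rightarrow> real"
  assumes f: "continuous_on UNIV f" "\<And>x. \<bar>f x\<bar> \<le> B"
    and grid: "mono t" "\<And>j. t (Suc j) - t j \<le> \<delta>" "0 < m" and "0 < \<delta>" "0 < K"
  defines "T \<equiv> t ` {..m}" and "\<kappa> \<equiv> K * \<delta>\<^sup>2"
  shows "\<bar>expectation (\<lambda>\<omega>. f (zeros (\<lambda>t. Y t \<omega>) {t 0..t m})) -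
      expectation (\<lambda>\<omega>. sign_pattern_average (\<lambda>A. f (of_nat (sign_changes t m A))) T (sin (\<kappa> / L)) L (\<lambda>t. Y t \<omega>))\<bar>
    \<le> 2 * B * (prob (space M - {\<omega>\<in>space M. \<forall>s\<in>{t 0..t m}. \<bar>Y2 s \<omega>\<bar> \<le> K}) +
        (\<Sum>s\<in>T. prob {\<omega>\<in>space M. \<bar>Y s \<omega>\<bar> \<le> \<kappa>} + prob {\<omega>\<in>space M. L \<le> \<bar>Y s \<omega>\<bar>}))"
proof -
  let ?Z = "\<lambda>\<omega>. f (zeros (\<lambda>t. Y t \<omega>) {t 0..t m})"
  let ?S = "\<lambda>\<omega>. sign_pattern_average (\<lambda>A. f (of_nat (sign_changes t m A))) T (sin (\<kappa> / L)) L (\<lambda>t. Y t \<omega>)"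
  let ?C = "space M - {\<omega>\<in>space M. \<forall>s\<in>{t 0..t m}. \<bar>Y2 s \<omega>\<bar> \<le> K}"
  let ?D = "\<lambda>s. {\<omega>\<in>space M. \<bar>Y s \<omega>\<bar> \<le> \<kappa>} \<union> {\<omega>\<in>space M. L \<le> \<bar>Y s \<omega>\<bar>}"
  define E where "E = ?C \<union> (\<Union>s\<in>T. ?D s)"
  have T: "finite T" by (simp add: T_def)
  have "0 < \<kappa>" using \<open>0 < K\<close> \<open>0 < \<delta>\<close> by (simp add: \<kappa>_def)
  have "0 \<le> B" using f(2)[of 0] by simp
  have C[measurable]: "?C \<in> sets M" by (intro sets.compl_sets curvature_event)
  have D[measurable]: "?D s \<in> sets M" for s by measurable
  have E[measurable]: "E \<in> sets M" unfolding E_def by (intro sets.Un C sets.finite_UN T D)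
  have good: "?Z \<omega> = ?S \<omega>" if \<omega>: "\<omega> \<in> space M" "\<omega> \<notin> E" for \<omega>
  proof -
    have Y2: "\<bar>Y2 s \<omega>\<bar> \<le> K" if "s \<in> {t 0..t m}" for s
      using \<omega> that unfolding E_def by blast
    have Y: "\<kappa> < \<bar>Y s \<omega>\<bar>" "\<bar>Y s \<omega>\<bar> \<le> L" if "s \<in> T" for s
      using \<omega> that unfolding E_def by force+
    have "zeros (\<lambda>t. Y t \<omega>) {t 0..t m} = of_nat (sign_changes t m {s. 0 < Y s \<omega>})"
      by (rule zeros_eq_sign_changes[OF deriv[OF \<omega>(1)] Y2 grid(1,2,3)])
         (use Y(1) \<open>0 < K\<close> in \<open>auto simp: T_def \<kappa>_def\<close>)
    moreover have "?S \<omega> = f (of_nat (sign_changes t m {s\<in>T. 0 < Y s \<omega>}))"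
      using Y by (intro sign_pattern_average_eq T \<open>0 < \<kappa>\<close>)
    ultimately show ?thesis by (simp add: T_def sign_changes_restrict)
  qed
  have S_le: "\<bar>?S \<omega>\<bar> \<le> B" for \<omega> by (intro abs_sign_pattern_average_le T f)
  have [measurable]: "?Z \<in> borel_measurable M"
    using measurable_compose[OF zero_count_measurable borel_measurable_continuous_onI[OF f(1)]] .
  have [measurable]: "ramp \<eta> \<in> borel_measurable borel" for \<eta>
    by (intro borel_measurable_continuous_onI continuous_on_ramp)
  have [measurable]: "?S \<in> borel_measurable M"
    unfolding sign_pattern_average_def by measurable
  have int: "integrable M ?Z" "integrable M ?S"
    using f(2) S_le by (auto intro!: integrable_const_bound[where B=B])
  have "\<bar>expectation ?Z - expectation ?S\<bar> = \<bar>expectation (\<lambda>\<omega>. ?Z \<omega> - ?S \<omega>)\<bar>" using int by simp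
  also have "\<dots> \<le> expectation (\<lambda>\<omega>. \<bar>?Z \<omega> - ?S \<omega>\<bar>)" by (rule integral_abs_bound)
  also have "\<dots> \<le> expectation (\<lambda>\<omega>. 2 * B * indicator E \<omega>)"
  proof (rule integral_mono)
    fix \<omega> assume "\<omega> \<in> space M"
    moreover have "\<bar>?Z \<omega> - ?S \<omega>\<bar> \<le> 2 * B" using f(2)[of "zeros (\<lambda>t. Y t \<omega>) {t 0..t m}"] S_le[of \<omega>] by linarith
    ultimately show "\<bar>?Z \<omega> - ?S \<omega>\<bar> \<le> 2 * B * indicator E \<omega>" using good[of \<omega>] by (cases "\<omega> \<in> E") auto
  qed (use int in \<open>auto intro!: integrable_real_indicator simp: emeasure_eq_measure\<close>)
  also have "\<dots> = 2 * B * prob E" by simp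
  finally have "\<bar>expectation ?Z - expectation ?S\<bar> \<le> 2 * B * prob E" .
  also have "prob E \<le> prob ?C + (\<Sum>s\<in>T. prob {\<omega>\<in>space M. \<bar>Y s \<omega>\<bar> \<le> \<kappa>} + prob {\<omega>\<in>space M. L \<le> \<bar>Y s \<omega>\<bar>})"
  proof -
    have "prob E \<le> prob ?C + prob (\<Union>s\<in>T. ?D s)"
      unfolding E_def by (intro measure_subadditive C sets.finite_UN T D) simp_all
    also have "prob (\<Union>s\<in>T. ?D s) \<le> (\<Sum>s\<in>T. prob (?D s))"
      using D by (intro measure_subadditive_finite T) auto
    also have "(\<Sum>s\<in>T. prob (?D s)) \<le> (\<Sum>s\<in>T. prob {\<omega>\<in>space M. \<bar>Y s \<omega>\<bar> \<le> \<kappa>} + prob {\<omega>\<in>space M. L \<le> \<bar>Y s \<omega>\<bar>})"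
      by (intro sum_mono measure_subadditive) simp_all
    finally show ?thesis by simp
  qed
  finally show ?thesis using \<open>0 \<le> B\<close> by (simp add: mult_left_mono)
qed

text \<open>
  Each path has a bounded second derivative on the compact interval, so the events decrease to the
  empty set.
\<close>
lemma curvature_tight:
  assumes "0 < \<epsilon>"
  shows "\<exists>K>0. prob (space M - {\<omega>\<in>space M. \<forall>t\<in>{c..d}. \<bar>Y2 t \<omega>\<bar> \<le> K}) \<le> \<epsilon>"
proof -
  let ?A = "\<lambda>n. space M - {\<omega>\<in>space M. \<forall>t\<in>{c..d}. \<bar>Y2 t \<omega>\<bar> \<le> real n}"
  have "(\<Inter>n. ?A n) = {}"
  proof -
    have "\<exists>n. \<omega> \<notin> ?A n" if \<omega>: "\<omega> \<in> space M" for \<omega>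
    proof -
      have "compact ((\<lambda>t. Y2 t \<omega>) ` {c..d})"
        by (intro compact_continuous_image continuous_on_subset[OF Y2_continuous[OF \<omega>]] compact_Icc) simp
      from compact_imp_bounded[OF this]
      obtain b where b: "\<And>t. t \<in> {c..d} \<Longrightarrow> \<bar>Y2 t \<omega>\<bar> \<le> b"
        unfolding bounded_iff by (metis imageI real_norm_def)
      obtain n where "b \<le> real n" using real_arch_simple by blast
      then have "\<bar>Y2 t \<omega>\<bar> \<le> real n" if "t \<in> {c..d}" for t
        using b[OF that] by linarith
      then show ?thesis by blast
    qed
    then show ?thesis by blast
  qed
  note empty = this
  have "(\<lambda>n. prob (?A n)) \<longlonglongrightarrow> prob (\<Inter>n. ?A n)"
  proof (rule finite_Lim_measure_decseq)
    show "range ?A \<subseteq> sets M" using sets.compl_sets[OF curvature_event] by blast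
    have "x \<le> real m \<Longrightarrow> x \<le> real n" if "m \<le> n" for x m n using that by linarith
    then show "decseq ?A" unfolding decseq_def by blast
  qed
  then have "(\<lambda>n. prob (?A n)) \<longlonglongrightarrow> 0" unfolding empty measure_empty .
  then have "\<forall>\<^sub>F n in sequentially. prob (?A n) < \<epsilon>" using \<open>0 < \<epsilon>\<close> by (rule order_tendstoD(2))
  with eventually_gt_at_top[of 0] have "\<forall>\<^sub>F n in sequentially. 0 < n \<and> prob (?A n) < \<epsilon>" by (rule eventually_conj)
  then obtain n where "0 < n" "prob (?A n) < \<epsilon>" using eventually_happens'[OF sequentially_bot] by blast
  then show ?thesis by (intro exI[of _ "real n"]) simp
qed

lemma curvature_prob_mono:
  assumes "K \<le> K'"
  shows "prob (space M - {\<omega>\<in>space M. \<forall>t\<in>{c..d}. \<bar>Y2 t \<omega>\<bar> \<le> K'}) \<le>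
    prob (space M - {\<omega>\<in>space M. \<forall>t\<in>{c..d}. \<bar>Y2 t \<omega>\<bar> \<le> K})"
proof (rule finite_measure_mono)
  have "(\<forall>t\<in>{c..d}. \<bar>Y2 t \<omega>\<bar> \<le> K) \<longrightarrow> (\<forall>t\<in>{c..d}. \<bar>Y2 t \<omega>\<bar> \<le> K')" for \<omega>
    using assms by (meson order_trans)
  then show "space M - {\<omega>\<in>space M. \<forall>t\<in>{c..d}. \<bar>Y2 t \<omega>\<bar> \<le> K'} \<subseteq>
      space M - {\<omega>\<in>space M. \<forall>t\<in>{c..d}. \<bar>Y2 t \<omega>\<bar> \<le> K}"
    by (intro Diff_mono order_refl Collect_mono conj_mono impI) simp_all
  show "space M - {\<omega>\<in>space M. \<forall>t\<in>{c..d}. \<bar>Y2 t \<omega>\<bar> \<le> K} \<in> sets M"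
    by (intro sets.compl_sets curvature_event)
qed

text \<open>
  The union bound of \<open>zeros_vs_sign_changes\<close> when each of its three contributions is at most \<open>\<epsilon>\<close>: the
  supremum of the second derivative, the small values on the grid, and the large ones (by Chebyshev's inequality).
\<close>
lemma zeros_approximation:
  fixes f :: "ennreal \<Rightarrow> real" and t :: "nat \<Rightarrow> real"
  assumes f: "continuous_on UNIV f" "\<And>x. \<bar>f x\<bar> \<le> B"
    and grid: "mono t" "\<And>j. t (Suc j) - t j \<le> \<delta>" "0 < m" and "0 < \<delta>" "0 < K" "0 < L"
    and sq: "\<And>s. integrable M (\<lambda>\<omega>. (Y s \<omega>)\<^sup>2)" "\<And>s. expectation (\<lambda>\<omega>. (Y s \<omega>)\<^sup>2) \<le> 1"
    and curvature: "prob (space M - {\<omega>\<in>space M. \<forall>s\<in>{t 0..t m}. \<bar>Y2 s \<omega>\<bar> \<le> K}) \<le> \<epsilon>"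
    and small: "\<And>s. s \<in> t ` {..m} \<Longrightarrow> prob {\<omega>\<in>space M. \<bar>Y s \<omega>\<bar> \<le> K * \<delta>\<^sup>2} \<le> 4 * (K * \<delta>\<^sup>2)"
    and \<epsilon>: "real (m + 1) * (4 * (K * \<delta>\<^sup>2)) \<le> \<epsilon>" "real (m + 1) * (1 / L\<^sup>2) \<le> \<epsilon>"
  shows "\<bar>expectation (\<lambda>\<omega>. f (zeros (\<lambda>t. Y t \<omega>) {t 0..t m})) -
      expectation (\<lambda>\<omega>. sign_pattern_average (\<lambda>A. f (of_nat (sign_changes t m A))) (t ` {..m})
        (sin (K * \<delta>\<^sup>2 / L)) L (\<lambda>t. Y t \<omega>))\<bar> \<le> 6 * B * \<epsilon>"
proof -
  let ?T = "t ` {..m}"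
  have "0 \<le> B" using f(2)[of 0] by simp
  have large: "prob {\<omega>\<in>space M. L \<le> \<bar>Y s \<omega>\<bar>} \<le> 1 / L\<^sup>2" for s
    by (rule order_trans[OF second_moment_method[OF Y_measurable sq(1) \<open>0 < L\<close>] divide_right_mono[OF sq(2)]]) simp
  have "(\<Sum>s\<in>?T. prob {\<omega>\<in>space M. \<bar>Y s \<omega>\<bar> \<le> K * \<delta>\<^sup>2} + prob {\<omega>\<in>space M. L \<le> \<bar>Y s \<omega>\<bar>})
      \<le> real (card ?T) * (4 * (K * \<delta>\<^sup>2) + 1 / L\<^sup>2)"
    by (rule sum_bounded_above) (intro add_mono small large)
  also have "\<dots> \<le> real (m + 1) * (4 * (K * \<delta>\<^sup>2) + 1 / L\<^sup>2)"
    using card_image_le[of "{..m}" t] \<open>0 < K\<close> by (intro mult_right_mono) auto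
  also have "\<dots> \<le> \<epsilon> + \<epsilon>" unfolding distrib_left[of "real (m + 1)"] using \<epsilon> by (rule add_mono)
  finally have "prob (space M - {\<omega>\<in>space M. \<forall>s\<in>{t 0..t m}. \<bar>Y2 s \<omega>\<bar> \<le> K}) +
     (\<Sum>s\<in>?T. prob {\<omega>\<in>space M. \<bar>Y s \<omega>\<bar> \<le> K * \<delta>\<^sup>2} + prob {\<omega>\<in>space M. L \<le> \<bar>Y s \<omega>\<bar>}) \<le> 3 * \<epsilon>"
    using curvature by linarith
  then have "2 * B * (prob (space M - {\<omega>\<in>space M. \<forall>s\<in>{t 0..t m}. \<bar>Y2 s \<omega>\<bar> \<le> K}) +
     (\<Sum>s\<in>?T. prob {\<omega>\<in>space M. \<bar>Y s \<omega>\<bar> \<le> K * \<delta>\<^sup>2} + prob {\<omega>\<in>space M. L \<le> \<bar>Y s \<omega>\<bar>})) \<le>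
     2 * B * (3 * \<epsilon>)"
    by (rule mult_left_mono) (use \<open>0 \<le> B\<close> in simp)
  also have "2 * B * (3 * \<epsilon>) = 6 * B * \<epsilon>" by simp
  finally show ?thesis
    by (rule order_trans[OF zeros_vs_sign_changes[OF f grid \<open>0 < \<delta>\<close> \<open>0 < K\<close>]])
qed

end

text \<open>
  The constants are chosen in the order \<open>K\<close>, \<open>m\<close>, \<open>L\<close>: first a bound \<open>K\<close> on the second derivatives, then a grid of \<open>m\<close> cells so
  fine that \<open>m K \<delta>\<^sup>2\<close> is small, then a truncation level \<open>L\<close> for the \<open>m + 1\<close> values on the grid. Only then
  \<open>N\<close> tends to infinity, with a fixed function of finitely many coordinates.
\<close>
theorem zeros_converge_in_distribution:
  fixes X X1 X2 :: "nat \<Rightarrow> real \<Rightarrow> 'a \<Rightarrow> real" and W W1 W2 :: "real \<Rightarrow> 'b \<Rightarrow> real"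
  assumes X: "\<And>N. C2_process M (X N) (X1 N) (X2 N)" and W: "C2_process M' W W1 W2"
    and char_conv: "\<And>F u. finite F \<Longrightarrow> (\<lambda>N. \<integral>\<omega>. iexp (\<Sum>t\<in>F. u t * X N t \<omega>) \<partial>M)
        \<longlonglongrightarrow> (\<integral>\<omega>. iexp (\<Sum>t\<in>F. u t * W t \<omega>) \<partial>M')"
    and char_W: "\<And>u t. (\<integral>\<omega>. iexp (u * W t \<omega>) \<partial>M') = of_real (exp (- u\<^sup>2 / 2))"
    and sq_X: "\<And>N t. integrable M (\<lambda>\<omega>. (X N t \<omega>)\<^sup>2)" "\<And>N t. (\<integral>\<omega>. (X N t \<omega>)\<^sup>2 \<partial>M) \<le> 1"
    and sq_W: "\<And>t. integrable M' (\<lambda>\<omega>. (W t \<omega>)\<^sup>2)" "\<And>t. (\<integral>\<omega>. (W t \<omega>)\<^sup>2 \<partial>M') \<le> 1"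
    and tight: "\<And>\<epsilon>. 0 < \<epsilon> \<Longrightarrow> \<exists>K>0. \<forall>N.
        measure M (space M - {\<omega>\<in>space M. \<forall>t\<in>{c..d}. \<bar>X2 N t \<omega>\<bar> \<le> K}) \<le> \<epsilon>"
    and "c \<le> d"
  shows "converges_in_distribution
    M (\<lambda>N \<omega>. zeros (\<lambda>t. X N t \<omega>) {c..d}) M' (\<lambda>\<omega>. zeros (\<lambda>t. W t \<omega>) {c..d})"
  unfolding converges_in_distribution_def
proof (intro conjI allI impI)
  interpret X: C2_process M "X N" "X1 N" "X2 N" for N by (rule X)
  interpret W: C2_process M' W W1 W2 by (rule W)
  show "(\<lambda>\<omega>. zeros (\<lambda>t. X N t \<omega>) {c..d}) \<in> borel_measurable M" for N by (rule X.zero_count_measurable)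
  show "(\<lambda>\<omega>. zeros (\<lambda>t. W t \<omega>) {c..d}) \<in> borel_measurable M'" by (rule W.zero_count_measurable)
  fix f :: "ennreal \<Rightarrow> real"
  assume f: "continuous_on UNIV f" "bounded (range f)"
  then obtain B where B: "\<And>x. \<bar>f x\<bar> \<le> B" by (auto simp: bounded_iff)
  have "0 \<le> B" using B[of 0] by simp
  show "(\<lambda>N. \<integral>\<omega>. f (zeros (\<lambda>t. X N t \<omega>) {c..d}) \<partial>M) \<longlonglongrightarrow> (\<integral>\<omega>. f (zeros (\<lambda>t. W t \<omega>) {c..d}) \<partial>M')"
  proof (rule LIMSEQ_I)
    fix e :: real assume "0 < e"
    \<comment> \<open>Two approximations at cost \<open>6 B \<epsilon>\<close> each, and \<open>\<epsilon>\<close> for the limit between them.\<close>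
    define \<epsilon> where "\<epsilon> = e / (12 * B + 1)"
    have "0 < \<epsilon>" using \<open>0 < e\<close> \<open>0 \<le> B\<close> by (simp add: \<epsilon>_def)
    obtain KX where KX: "0 < KX"
      "\<And>N. measure M (space M - {\<omega>\<in>space M. \<forall>t\<in>{c..d}. \<bar>X2 N t \<omega>\<bar> \<le> KX}) \<le> \<epsilon>"
      using tight[OF \<open>0 < \<epsilon>\<close>] by blast
    obtain KW where KW: "0 < KW"
      "measure M' (space M' - {\<omega>\<in>space M'. \<forall>t\<in>{c..d}. \<bar>W2 t \<omega>\<bar> \<le> KW}) \<le> \<epsilon>"
      using W.curvature_tight[OF \<open>0 < \<epsilon>\<close>] by blast
    define K where "K = max KX KW"
    have "0 < K" using KX(1) by (simp add: K_def)
    have curvature_X: "measure M (space M - {\<omega>\<in>space M. \<forall>t\<in>{c..d}. \<bar>X2 N t \<omega>\<bar> \<le> K}) \<le> \<epsilon>" for N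
      by (rule order_trans[OF X.curvature_prob_mono KX(2)]) (simp add: K_def)
    have curvature_W: "measure M' (space M' - {\<omega>\<in>space M'. \<forall>t\<in>{c..d}. \<bar>W2 t \<omega>\<bar> \<le> K}) \<le> \<epsilon>"
      by (rule order_trans[OF W.curvature_prob_mono KW(2)]) (simp add: K_def)
    have "(\<lambda>m. (4 * K * (d - c + 1)\<^sup>2) * (real (m + 1) / (real m)\<^sup>2)) \<longlonglongrightarrow> (4 * K * (d - c + 1)\<^sup>2) * 0"
      by (intro tendsto_mult_left) real_asymp
    then have "\<forall>\<^sub>F m in sequentially. (4 * K * (d - c + 1)\<^sup>2) * (real (m + 1) / (real m)\<^sup>2) < \<epsilon>"
      using \<open>0 < \<epsilon>\<close> by (intro order_tendstoD(2)) auto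
    with eventually_gt_at_top[of 0]
    have "\<forall>\<^sub>F m in sequentially. 0 < m \<and> (4 * K * (d - c + 1)\<^sup>2) * (real (m + 1) / (real m)\<^sup>2) < \<epsilon>"
      by (rule eventually_conj)
    then obtain m :: nat where m: "0 < m" "(4 * K * (d - c + 1)\<^sup>2) * (real (m + 1) / (real m)\<^sup>2) < \<epsilon>"
      using eventually_happens'[OF sequentially_bot] by blast
    \<comment> \<open>The summand \<open>1\<close> keeps \<open>\<delta>\<close> positive when \<open>I\<close> is a single point.\<close>
    define \<delta> where "\<delta> = (d - c + 1) / real m"
    define \<kappa> where "\<kappa> = K * \<delta>\<^sup>2"
    \<comment> \<open>Each of the \<open>m + 1\<close> values exceeds \<open>L\<close> with probability at most \<open>1 / L\<^sup>2\<close>.\<close>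
    define L where "L = sqrt (real (m + 1) / \<epsilon>)"
    define t where "t j = c + real j * ((d - c) / real m)" for j
    define T where "T = t ` {..m}"
    have "0 < \<delta>" using m(1) \<open>c \<le> d\<close> by (simp add: \<delta>_def)
    have "0 < \<kappa>" using \<open>0 < K\<close> \<open>0 < \<delta>\<close> by (simp add: \<kappa>_def)
    have "0 < L" using \<open>0 < \<epsilon>\<close> by (simp add: L_def)
    have t: "t 0 = c" "t m = d" using m(1) by (simp_all add: t_def)
    have "mono t"
      using \<open>c \<le> d\<close> unfolding t_def by (intro monoI add_left_mono mult_right_mono) auto
    moreover have "t (Suc j) - t j \<le> \<delta>" for j
    proof -
      have "t (Suc j) - t j = (d - c) / real m" by (simp add: t_def algebra_simps add_divide_distrib diff_divide_distrib)
      then show ?thesis using m(1) by (simp add: \<delta>_def divide_right_mono)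
    qed
    ultimately have grid: "mono t" "\<And>j. t (Suc j) - t j \<le> \<delta>" by blast+
    have "finite T" by (simp add: T_def)
    have \<epsilon>1: "real (m + 1) * (4 * \<kappa>) \<le> \<epsilon>"
      using m(2) by (simp add: \<kappa>_def \<delta>_def power_divide mult_ac)
    have \<epsilon>2: "real (m + 1) * (1 / L\<^sup>2) \<le> \<epsilon>"
      using \<open>0 < \<epsilon>\<close> by (simp add: L_def)
    let ?g = "\<lambda>A. f (of_nat (sign_changes t m A))"
    let ?SX = "\<lambda>N. \<integral>\<omega>. sign_pattern_average ?g T (sin (\<kappa> / L)) L (\<lambda>t. X N t \<omega>) \<partial>M"
    let ?SW = "\<integral>\<omega>. sign_pattern_average ?g T (sin (\<kappa> / L)) L (\<lambda>t. W t \<omega>) \<partial>M'"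
    let ?ZX = "\<lambda>N. \<integral>\<omega>. f (zeros (\<lambda>t. X N t \<omega>) {c..d}) \<partial>M"
    let ?ZW = "\<integral>\<omega>. f (zeros (\<lambda>t. W t \<omega>) {c..d}) \<partial>M'"
    interpret fidi: fidi_convergence M M' X W T
      using \<open>finite T\<close> char_conv by unfold_locales auto
    have conv_X: "(\<lambda>N. \<integral>\<omega>. iexp (u * X N s \<omega>) \<partial>M) \<longlonglongrightarrow> of_real (exp (- u\<^sup>2 / 2))" for u s
      using char_conv[of "{s}" "\<lambda>_. u"] unfolding char_W[symmetric, of u s] by simp
    \<comment> \<open>The values of \<open>X N\<close> and of \<open>W\<close> are treated alike, \<open>W\<close> being a constant sequence.\<close>
    have small_X: "\<forall>\<^sub>F N in sequentially. \<forall>s\<in>T. measure M {\<omega>\<in>space M. \<bar>X N s \<omega>\<bar> \<le> \<kappa>} \<le> 4 * \<kappa>"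
      using \<open>finite T\<close> \<open>0 < \<kappa>\<close> conv_X
      by (intro eventually_ball_finite ballI gaussian_limit_anticoncentration X.prob_space_axioms X.Y_measurable)
    have "measure M' {\<omega>\<in>space M'. \<bar>W s \<omega>\<bar> \<le> \<kappa>} \<le> 4 * \<kappa>" for s
      using gaussian_limit_anticoncentration[of M' "\<lambda>_. W s" \<kappa>] W.prob_space_axioms \<open>0 < \<kappa>\<close>
      unfolding char_W by simp
    then have ZW: "\<bar>?ZW - ?SW\<bar> \<le> 6 * B * \<epsilon>"
      using W.zeros_approximation[of f B t \<delta> m K L \<epsilon>, unfolded t, folded \<kappa>_def T_def,
          OF f(1) B grid m(1) \<open>0 < \<delta>\<close> \<open>0 < K\<close> \<open>0 < L\<close> sq_W curvature_W _ \<epsilon>1 \<epsilon>2] by simp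
    have "\<forall>\<^sub>F N in sequentially. \<bar>?SX N - ?SW\<bar> < \<epsilon>"
      using tendstoD[OF fidi.sign_pattern_average_convergence \<open>0 < \<epsilon>\<close>] by (simp add: dist_real_def)
    with small_X have "\<forall>\<^sub>F N in sequentially. norm (?ZX N - ?ZW) < e"
    proof eventually_elim
      case (elim N)
      have "\<bar>?ZX N - ?SX N\<bar> \<le> 6 * B * \<epsilon>"
        by (rule X.zeros_approximation[of f B t \<delta> m K L N \<epsilon>, unfolded t, folded \<kappa>_def T_def,
              OF f(1) B grid m(1) \<open>0 < \<delta>\<close> \<open>0 < K\<close> \<open>0 < L\<close> sq_X curvature_X _ \<epsilon>1 \<epsilon>2])
           (use elim(1) in blast)
      with elim(2) ZW have "\<bar>?ZX N - ?ZW\<bar> < 12 * (B * \<epsilon>) + \<epsilon>" by linarith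
      also have "\<dots> = (12 * B + 1) * \<epsilon>" by (simp add: algebra_simps)
      also have "\<dots> = e" using \<open>0 \<le> B\<close> by (simp add: \<epsilon>_def)
      finally show ?case by simp
    qed
    then show "\<exists>N0. \<forall>N\<ge>N0. norm (?ZX N - ?ZW) < e" unfolding eventually_sequentially .
  qed
qed

section \<open>A maximal inequality\<close>

lemma abs_le_initial_plus_variation:
  fixes g g' :: "real \<Rightarrow> real"
  assumes der: "\<And>s. (g has_real_derivative g' s) (at s)" and cont: "continuous_on UNIV g'"
    and t: "t \<in> {c..d}"
  shows "ennreal \<bar>g t\<bar> \<le> ennreal \<bar>g c\<bar> + (\<integral>\<^sup>+s. ennreal \<bar>g' s\<bar> * indicator {c..d} s \<partial>lborel)"
proof -
  have FTC: "has_bochner_integral lborel (\<lambda>s. g' s * indicator {c..t} s) (g t - g c)"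
    using t der cont
    by (intro has_bochner_integral_FTC_Icc_real) (auto simp: continuous_on_eq_continuous_at)
  have "ennreal \<bar>g t - g c\<bar> \<le> (\<integral>\<^sup>+s. norm (g' s * indicator {c..t} s) \<partial>lborel)"
    using has_bochner_integral_norm_bound[OF FTC] by simp
  also have "\<dots> \<le> (\<integral>\<^sup>+s. ennreal \<bar>g' s\<bar> * indicator {c..d} s \<partial>lborel)"
    using t by (intro nn_integral_mono) (auto simp: indicator_def)
  finally have "ennreal \<bar>g c\<bar> + ennreal \<bar>g t - g c\<bar> \<le>
      ennreal \<bar>g c\<bar> + (\<integral>\<^sup>+s. ennreal \<bar>g' s\<bar> * indicator {c..d} s \<partial>lborel)"
    by (rule add_left_mono)
  moreover have "ennreal \<bar>g t\<bar> \<le> ennreal \<bar>g c\<bar> + ennreal \<bar>g t - g c\<bar>"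
    by (simp flip: ennreal_plus)
  ultimately show ?thesis by (rule order_trans[rotated])
qed

lemma (in prob_space) nn_integral_abs_le_1:
  assumes [measurable]: "X \<in> borel_measurable M"
    and "integrable M (\<lambda>\<omega>. (X \<omega>)\<^sup>2)" "expectation (\<lambda>\<omega>. (X \<omega>)\<^sup>2) \<le> 1"
  shows "(\<integral>\<^sup>+\<omega>. ennreal \<bar>X \<omega>\<bar> \<partial>M) \<le> 1"
proof -
  have "\<bar>x\<bar> \<le> 1 / 2 + x\<^sup>2 / 2" for x :: real
    using sum_squares_bound[of "\<bar>x\<bar>" 1] by simp
  then have "(\<integral>\<^sup>+\<omega>. ennreal \<bar>X \<omega>\<bar> \<partial>M) \<le> (\<integral>\<^sup>+\<omega>. ennreal (1 / 2 + (X \<omega>)\<^sup>2 / 2) \<partial>M)"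
    by (intro nn_integral_mono ennreal_leI)
  also have "\<dots> = ennreal (expectation (\<lambda>\<omega>. 1 / 2 + (X \<omega>)\<^sup>2 / 2))"
    using assms(2) by (intro nn_integral_eq_integral) auto
  also have "expectation (\<lambda>\<omega>. 1 / 2 + (X \<omega>)\<^sup>2 / 2) = 1 / 2 + expectation (\<lambda>\<omega>. (X \<omega>)\<^sup>2) / 2"
    using assms(2) by (simp add: prob_space)
  also have "ennreal \<dots> \<le> ennreal 1"
    using assms(3) by (intro ennreal_leI) simp
  finally show ?thesis by simp
qed

text \<open>
  The supremum is at most \<open>\<bar>Y c\<bar>\<close> plus the integral of \<open>\<bar>Y'\<bar>\<close>, whose expectation is at most
  \<open>1 + (d - c)\<close> by Fubini's theorem; Markov's inequality concludes.
\<close>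
lemma (in prob_space) maximal_inequality:
  fixes Y Y' :: "real \<Rightarrow> 'a \<Rightarrow> real"
  assumes meas: "\<And>t. Y t \<in> borel_measurable M"
    and joint[measurable]: "(\<lambda>(\<omega>, s). Y' s \<omega>) \<in> borel_measurable (M \<Otimes>\<^sub>M lborel)"
    and der: "\<And>\<omega> s. \<omega> \<in> space M \<Longrightarrow> ((\<lambda>t. Y t \<omega>) has_real_derivative Y' s \<omega>) (at s)"
    and cont: "\<And>\<omega>. \<omega> \<in> space M \<Longrightarrow> continuous_on UNIV (\<lambda>s. Y' s \<omega>)"
    and sq: "\<And>t. integrable M (\<lambda>\<omega>. (Y t \<omega>)\<^sup>2)" "\<And>t. expectation (\<lambda>\<omega>. (Y t \<omega>)\<^sup>2) \<le> 1"
      "\<And>t. integrable M (\<lambda>\<omega>. (Y' t \<omega>)\<^sup>2)" "\<And>t. expectation (\<lambda>\<omega>. (Y' t \<omega>)\<^sup>2) \<le> 1"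
    and "c \<le> d" "0 < K"
  shows "prob (space M - {\<omega>\<in>space M. \<forall>t\<in>{c..d}. \<bar>Y t \<omega>\<bar> \<le> K}) \<le> (1 + (d - c)) / K"
proof -
  note [measurable] = meas
  have meas'[measurable]: "Y' t \<in> borel_measurable M" for t
  proof -
    have "(\<lambda>\<omega>. (\<omega>, t)) \<in> measurable M (M \<Otimes>\<^sub>M lborel)" by measurable
    from measurable_compose[OF this joint] show ?thesis by simp
  qed
  \<comment> \<open>\<open>V\<close> dominates the whole path on \<open>[c, d]\<close> and is a measurable function of \<open>\<omega>\<close>.\<close>
  define V where "V \<omega> = ennreal \<bar>Y c \<omega>\<bar> + (\<integral>\<^sup>+s. ennreal \<bar>Y' s \<omega>\<bar> * indicator {c..d} s \<partial>lborel)" for \<omega>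
  have [measurable]: "V \<in> borel_measurable M" unfolding V_def by measurable
  have "(\<integral>\<^sup>+\<omega>. V \<omega> \<partial>M) = (\<integral>\<^sup>+\<omega>. ennreal \<bar>Y c \<omega>\<bar> \<partial>M) +
      (\<integral>\<^sup>+\<omega>. (\<integral>\<^sup>+s. ennreal \<bar>Y' s \<omega>\<bar> * indicator {c..d} s \<partial>lborel) \<partial>M)"
    unfolding V_def by (intro nn_integral_add) measurable
  also have "(\<integral>\<^sup>+\<omega>. (\<integral>\<^sup>+s. ennreal \<bar>Y' s \<omega>\<bar> * indicator {c..d} s \<partial>lborel) \<partial>M) =
      (\<integral>\<^sup>+s. (\<integral>\<^sup>+\<omega>. ennreal \<bar>Y' s \<omega>\<bar> * indicator {c..d} s \<partial>M) \<partial>lborel)"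
    by (intro pair_sigma_finite.Fubini'[symmetric])
       (simp_all add: pair_sigma_finite_def sigma_finite_measure_axioms lborel.sigma_finite_measure_axioms)
  also have "\<dots> = (\<integral>\<^sup>+s. (\<integral>\<^sup>+\<omega>. ennreal \<bar>Y' s \<omega>\<bar> \<partial>M) * indicator {c..d} s \<partial>lborel)"
    by (intro nn_integral_cong nn_integral_multc) measurable
  also have "\<dots> \<le> (\<integral>\<^sup>+s. 1 * indicator {c..d} s \<partial>lborel)"
    by (intro nn_integral_mono mult_right_mono nn_integral_abs_le_1 meas' sq) simp
  also have "\<dots> = ennreal (d - c)" using \<open>c \<le> d\<close> by simp
  also have "(\<integral>\<^sup>+\<omega>. ennreal \<bar>Y c \<omega>\<bar> \<partial>M) \<le> 1"
    by (intro nn_integral_abs_le_1 meas sq)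
  finally have EV: "(\<integral>\<^sup>+\<omega>. V \<omega> \<partial>M) \<le> ennreal (1 + (d - c))"
    using \<open>c \<le> d\<close> by (simp add: ennreal_plus add_mono)
  let ?E = "{\<omega>\<in>space M. 1 \<le> ennreal (1 / K) * V \<omega>}"
  have sub: "space M - {\<omega>\<in>space M. \<forall>t\<in>{c..d}. \<bar>Y t \<omega>\<bar> \<le> K} \<subseteq> ?E"
  proof
    fix \<omega> assume "\<omega> \<in> space M - {\<omega>\<in>space M. \<forall>t\<in>{c..d}. \<bar>Y t \<omega>\<bar> \<le> K}"
    then obtain t where \<omega>: "\<omega> \<in> space M" and t: "t \<in> {c..d}" "K < \<bar>Y t \<omega>\<bar>" by force
    have "ennreal K \<le> ennreal \<bar>Y t \<omega>\<bar>" using t by (intro ennreal_leI) simp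
    also have "\<dots> \<le> V \<omega>" unfolding V_def
      by (rule abs_le_initial_plus_variation[OF der[OF \<omega>] cont[OF \<omega>] t(1)])
    finally have "ennreal (1 / K) * ennreal K \<le> ennreal (1 / K) * V \<omega>" by (rule mult_left_mono) simp
    then show "\<omega> \<in> ?E" using \<omega> \<open>0 < K\<close> by (simp flip: ennreal_mult)
  qed
  have "emeasure M ?E \<le> ennreal (1 / K) * (\<integral>\<^sup>+\<omega>. V \<omega> * indicator (space M) \<omega> \<partial>M)"
    by (rule nn_integral_Markov_inequality) simp_all
  also have "(\<integral>\<^sup>+\<omega>. V \<omega> * indicator (space M) \<omega> \<partial>M) = (\<integral>\<^sup>+\<omega>. V \<omega> \<partial>M)"
    by (intro nn_integral_cong) simp
  also have "ennreal (1 / K) * \<dots> \<le> ennreal (1 / K) * ennreal (1 + (d - c))"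
    using EV by (rule mult_left_mono) simp
  also have "\<dots> = ennreal ((1 + (d - c)) / K)"
    using \<open>0 < K\<close> \<open>c \<le> d\<close> by (subst ennreal_mult[symmetric]) simp_all
  finally have "prob ?E \<le> (1 + (d - c)) / K"
    using \<open>0 < K\<close> \<open>c \<le> d\<close> by (simp add: emeasure_eq_measure)
  moreover have "prob (space M - {\<omega>\<in>space M. \<forall>t\<in>{c..d}. \<bar>Y t \<omega>\<bar> \<le> K}) \<le> prob ?E"
    by (intro finite_measure_mono sub) simp
  ultimately show ?thesis by simp
qed

section \<open>Random trigonometric polynomials\<close>

text \<open>
  The Riemann sums for \<open>\<integral>\<^sub>0\<^sup>1 cos (\<theta> x) dx\<close> have a closed form, since multiplication by
  \<open>2 sin (\<theta> / 2N)\<close> makes them telescope (the Dirichlet kernel).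
\<close>
lemma riemann_sum_cos:
  "(\<lambda>N. (\<Sum>n=1..N. cos (real n * \<theta> / real N)) / real N) \<longlonglongrightarrow> sinc \<theta>"
proof (cases "\<theta> = 0")
  case True
  have "\<forall>\<^sub>F N in sequentially. 1 = (\<Sum>n=1..N. cos (real n * \<theta> / real N)) / real N"
    using eventually_gt_at_top[of 0] by eventually_elim (simp add: True)
  then show ?thesis using True by (simp add: tendsto_eventually eventually_mono)
next
  case False
  have closed: "2 * sin (x / 2) * (\<Sum>n=1..N. cos (real n * x)) = sin (real N * x + x / 2) - sin (x / 2)" for x N
  proof (induction N)
    case (Suc N)
    have "2 * sin (x / 2) * cos (real (Suc N) * x) = sin (real (Suc N) * x + x / 2) - sin (real N * x + x / 2)"
      unfolding sin_diff_sin by (simp add: algebra_simps add_divide_distrib diff_divide_distrib)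
    then show ?case using Suc by (simp add: distrib_left)
  qed simp
  have "(\<lambda>N. (sin (\<theta> + \<theta> / (2 * real N)) - sin (\<theta> / (2 * real N))) / (2 * real N * sin (\<theta> / (2 * real N)))) \<longlonglongrightarrow> sin \<theta> / \<theta>"
    using False by (real_asymp, simp add: field_simps)
  moreover have "\<forall>\<^sub>F N in sequentially. sin (\<theta> / (2 * real N)) \<noteq> 0"
  proof -
    have "\<forall>\<^sub>F N in sequentially. \<bar>\<theta>\<bar> / (2 * real N) < pi"
      by (rule order_tendstoD(2)[of _ 0]) (real_asymp, simp)
    then show ?thesis using eventually_gt_at_top[of 0]
    proof eventually_elim
      case (elim N)
      have "sin (\<bar>\<theta>\<bar> / (2 * real N)) > 0" using elim False by (intro sin_gt_zero) auto
      then show ?case by (cases "\<theta> \<ge> 0") auto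
    qed
  qed
  then have "\<forall>\<^sub>F N in sequentially. (sin (\<theta> + \<theta> / (2 * real N)) - sin (\<theta> / (2 * real N))) / (2 * real N * sin (\<theta> / (2 * real N)))
     = (\<Sum>n=1..N. cos (real n * \<theta> / real N)) / real N"
    using eventually_gt_at_top[of 0]
  proof eventually_elim
    case (elim N)
    have "\<theta> / real N / 2 = \<theta> / (2 * real N)" "real N * (\<theta> / real N) = \<theta>" using elim by auto
    then have "2 * sin (\<theta> / (2 * real N)) * (\<Sum>n=1..N. cos (real n * \<theta> / real N)) =
        sin (\<theta> + \<theta> / (2 * real N)) - sin (\<theta> / (2 * real N))"
      using closed[of "\<theta> / real N" N] elim(2) by (simp add: mult.commute)
    from this[symmetric] show ?case using elim by simp
  qed
  ultimately show ?thesis using False by simp (rule Lim_transform_eventually)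
qed

text \<open>
  The coefficients of the \<open>k\<close>-th derivative of the random trigonometric polynomial. The derivative of a sine or
  cosine is a shift by \<open>pi / 2\<close>, which gives one formula for all \<open>k\<close>; \<open>Inl n\<close> stands for the coefficient
  \<open>a n\<close> and \<open>Inr n\<close> for \<open>b n\<close>.
\<close>
definition trig_weight :: "nat \<Rightarrow> nat \<Rightarrow> real \<Rightarrow> nat + nat \<Rightarrow> real" where
  "trig_weight k N t i = (case i of
     Inl n \<Rightarrow> (real n / real N) ^ k * cos (real n * t / real N + real k * (pi / 2)) / sqrt (real N)
   | Inr n \<Rightarrow> (real n / real N) ^ k * sin (real n * t / real N + real k * (pi / 2)) / sqrt (real N))"

definition trig_poly_derivative :: "(nat + nat \<Rightarrow> 'a \<Rightarrow> real) \<Rightarrow> nat \<Rightarrow> nat \<Rightarrow> real \<Rightarrow> 'a \<Rightarrow> real" where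
  "trig_poly_derivative \<xi> k N t \<omega> = (\<Sum>i\<in>{1..N} <+> {1..N}. trig_weight k N t i * \<xi> i \<omega>)"

lemma trig_poly_derivative_0: "trig_poly_derivative (case_sum a b) 0 N t \<omega> = trig_poly a b N t \<omega>"
  by (simp add: trig_poly_derivative_def trig_poly_def trig_weight_def sum.Plus sum.distrib
      sum_distrib_left sum_divide_distrib mult.commute distrib_left)

lemma has_derivative_trig_weight:
  "((\<lambda>t. trig_weight k N t i) has_real_derivative trig_weight (Suc k) N t i) (at t)"
proof -
  have "cos (x + real (Suc k) * (pi / 2)) = - sin (x + real k * (pi / 2))"
    "sin (x + real (Suc k) * (pi / 2)) = cos (x + real k * (pi / 2))" for x
  proof -
    have "x + real (Suc k) * (pi / 2) = (x + real k * (pi / 2)) + pi / 2" by (simp add: field_simps)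
    then show "cos (x + real (Suc k) * (pi / 2)) = - sin (x + real k * (pi / 2))"
      "sin (x + real (Suc k) * (pi / 2)) = cos (x + real k * (pi / 2))"
      by (simp_all only: cos_add[of _ "pi / 2"] sin_add[of _ "pi / 2"] cos_pi_half sin_pi_half
          mult_zero_right mult_1_right add_0_left diff_0)
  qed
  note shift = this
  have "((\<lambda>t. w ^ k * cos (w * t + \<theta>) / r) has_real_derivative w ^ Suc k * - sin (w * t + \<theta>) / r) (at t)"
    "((\<lambda>t. w ^ k * sin (w * t + \<theta>) / r) has_real_derivative w ^ Suc k * cos (w * t + \<theta>) / r) (at t)"
    for w \<theta> r :: real
    by (cases "r = 0"; auto intro!: derivative_eq_intros)+
  from this[of "real n / real N" for n] show ?thesis
    unfolding trig_weight_def shift times_divide_eq_left by (cases i) simp_all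
qed

lemma has_derivative_trig_poly_derivative:
  "((\<lambda>t. trig_poly_derivative \<xi> k N t \<omega>) has_real_derivative trig_poly_derivative \<xi> (Suc k) N t \<omega>) (at t)"
  unfolding trig_poly_derivative_def
  by (intro DERIV_sum DERIV_cmult_right has_derivative_trig_weight)

lemma continuous_on_trig_poly_derivative: "continuous_on A (\<lambda>t. trig_poly_derivative \<xi> k N t \<omega>)"
  by (rule DERIV_continuous_on, rule has_field_derivative_at_within, rule has_derivative_trig_poly_derivative)

text \<open>
  The identity \<open>cos x cos y + sin x sin y = cos (x - y)\<close> pairs the two coefficients of each frequency; so
  the covariance depends only on \<open>s - t\<close>.
\<close>
lemma sum_trig_weight_product:
  assumes "0 < N"
  shows "(\<Sum>i\<in>{1..N} <+> {1..N}. trig_weight k N s i * trig_weight k N t i) =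
    (\<Sum>n=1..N. (real n / real N) ^ (2 * k) * cos (real n * (s - t) / real N)) / real N"
proof -
  have "(r * cos x / sqrt N) * (r * cos y / sqrt N) + (r * sin x / sqrt N) * (r * sin y / sqrt N)
    = r\<^sup>2 * cos (x - y) / real N" for r x y
  proof -
    have "(r * cos x / sqrt N) * (r * cos y / sqrt N) + (r * sin x / sqrt N) * (r * sin y / sqrt N)
      = r\<^sup>2 * (cos x * cos y + sin x * sin y) / (sqrt N * sqrt N)"
      by (simp add: add_divide_distrib power2_eq_square algebra_simps)
    then show ?thesis by (simp add: cos_diff)
  qed
  note * = this
  have "(\<Sum>i\<in>{1..N} <+> {1..N}. trig_weight k N s i * trig_weight k N t i) =
    (\<Sum>n=1..N. ((real n / real N) ^ k)\<^sup>2 *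
      cos ((real n * s / real N + real k * (pi / 2)) - (real n * t / real N + real k * (pi / 2))) / real N)"
    unfolding sum.Plus[OF finite_atLeastAtMost finite_atLeastAtMost] o_def trig_weight_def sum.case
      sum.distrib[symmetric] * ..
  also have "\<dots> = (\<Sum>n=1..N. (real n / real N) ^ (2 * k) * cos (real n * (s - t) / real N)) / real N"
    by (simp add: sum_divide_distrib power_mult[symmetric] mult.commute[of k] diff_divide_distrib
        right_diff_distrib)
  finally show ?thesis .
qed

lemma sum_trig_weight_square_le_1: "(\<Sum>i\<in>{1..N} <+> {1..N}. (trig_weight k N t i)\<^sup>2) \<le> 1"
proof (cases "N = 0")
  case False
  have "(\<Sum>i\<in>{1..N} <+> {1..N}. (trig_weight k N t i)\<^sup>2) = (\<Sum>n=1..N. (real n / real N) ^ (2 * k)) / real N"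
    using sum_trig_weight_product[of N k t t] False by (simp add: power2_eq_square)
  also have "\<dots> \<le> (\<Sum>n=1..N. 1) / real N"
    using False by (intro divide_right_mono sum_mono power_le_one) auto
  also have "\<dots> = 1" using False by simp
  finally show ?thesis .
qed (simp add: Plus_def)

lemma abs_trig_weight_le:
  assumes "i \<in> {1..N} <+> {1..N}"
  shows "\<bar>trig_weight 0 N t i\<bar> \<le> 1 / sqrt (real N)"
  using assms by (auto simp: trig_weight_def abs_mult divide_right_mono)

lemma trig_poly_derivative_second_moment:
  assumes iid: "standardized_iid M \<xi> I \<mu>" and "{1..N} <+> {1..N} \<subseteq> I"
  shows "integrable M (\<lambda>\<omega>. (trig_poly_derivative \<xi> k N t \<omega>)\<^sup>2)"
    "(\<integral>\<omega>. (trig_poly_derivative \<xi> k N t \<omega>)\<^sup>2 \<partial>M) \<le> 1"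
  using standardized_iid.second_moment_weighted_sum[OF assms(1,2), of "trig_weight k N t"]
    sum_trig_weight_square_le_1[of k N t]
  unfolding trig_poly_derivative_def by auto

text \<open>
  A linear combination of values is a weighted sum of the coefficients with weights
  \<open>O(1 / sqrt N)\<close>. Its variance is a combination of the Riemann sums above.
\<close>
theorem trig_poly_fidi_convergence:
  assumes iid: "standardized_iid M \<xi> I \<mu>" and "\<And>N. {1..N} <+> {1..N} \<subseteq> I" "finite F"
  shows "(\<lambda>N. \<integral>\<omega>. iexp (\<Sum>t\<in>F. u t * trig_poly_derivative \<xi> 0 N t \<omega>) \<partial>M) \<longlonglongrightarrow>
    of_real (exp (- (\<Sum>s\<in>F. \<Sum>t\<in>F. u s * u t * sinc (s - t)) / 2))"
proof -
  let ?w = "\<lambda>N i. \<Sum>t\<in>F. u t * trig_weight 0 N t i" and ?J = "\<lambda>N. {1..N} <+> {1..N}"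
  have eq: "(\<Sum>t\<in>F. u t * trig_poly_derivative \<xi> 0 N t \<omega>) = (\<Sum>i\<in>?J N. ?w N i * \<xi> i \<omega>)" for N \<omega>
  proof -
    have "(\<Sum>t\<in>F. u t * trig_poly_derivative \<xi> 0 N t \<omega>) =
        (\<Sum>t\<in>F. \<Sum>i\<in>?J N. u t * trig_weight 0 N t i * \<xi> i \<omega>)"
      by (simp add: trig_poly_derivative_def sum_distrib_left mult.assoc)
    also have "\<dots> = (\<Sum>i\<in>?J N. \<Sum>t\<in>F. u t * trig_weight 0 N t i * \<xi> i \<omega>)" by (rule sum.swap)
    finally show ?thesis by (simp add: sum_distrib_right)
  qed
  show ?thesis
    unfolding eq
  proof (rule standardized_iid.lindeberg_weighted_sum[OF iid])
    fix \<delta> :: real assume "0 < \<delta>"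
    have "(\<lambda>N. (\<Sum>t\<in>F. \<bar>u t\<bar>) * (1 / sqrt (real N))) \<longlonglongrightarrow> (\<Sum>t\<in>F. \<bar>u t\<bar>) * 0"
      by (intro tendsto_mult_left) real_asymp
    then have "\<forall>\<^sub>F N in sequentially. (\<Sum>t\<in>F. \<bar>u t\<bar>) * (1 / sqrt (real N)) < \<delta>"
      using \<open>0 < \<delta>\<close> by (intro order_tendstoD(2)) auto
    then show "\<forall>\<^sub>F N in sequentially. \<forall>i\<in>?J N. \<bar>?w N i\<bar> \<le> \<delta>"
    proof eventually_elim
      case (elim N)
      show ?case
      proof
        fix i assume i: "i \<in> ?J N"
        have "\<bar>?w N i\<bar> \<le> (\<Sum>t\<in>F. \<bar>u t\<bar> * \<bar>trig_weight 0 N t i\<bar>)"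
          by (rule order_trans[OF sum_abs]) (simp add: abs_mult)
        also have "\<dots> \<le> (\<Sum>t\<in>F. \<bar>u t\<bar> * (1 / sqrt (real N)))"
          by (intro sum_mono mult_left_mono abs_trig_weight_le i) simp
        also have "\<dots> < \<delta>" using elim by (simp add: sum_distrib_right sum_divide_distrib)
        finally show "\<bar>?w N i\<bar> \<le> \<delta>" by simp
      qed
    qed
  next
    have "\<forall>\<^sub>F N in sequentially.
      (\<Sum>s\<in>F. \<Sum>t\<in>F. u s * u t * ((\<Sum>n=1..N. cos (real n * (s - t) / real N)) / real N)) = (\<Sum>i\<in>?J N. (?w N i)\<^sup>2)"
      using eventually_gt_at_top[of 0]
    proof eventually_elim
      case (elim N)
      have "(\<Sum>i\<in>?J N. (?w N i)\<^sup>2) = (\<Sum>i\<in>?J N. \<Sum>s\<in>F. \<Sum>t\<in>F. u s * u t * (trig_weight 0 N s i * trig_weight 0 N t i))"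
        by (simp add: power2_eq_square sum_product mult_ac)
      also have "\<dots> = (\<Sum>s\<in>F. \<Sum>i\<in>?J N. \<Sum>t\<in>F. u s * u t * (trig_weight 0 N s i * trig_weight 0 N t i))"
        by (rule sum.swap)
      also have "\<dots> = (\<Sum>s\<in>F. \<Sum>t\<in>F. \<Sum>i\<in>?J N. u s * u t * (trig_weight 0 N s i * trig_weight 0 N t i))"
        by (intro sum.cong refl sum.swap)
      also have "\<dots> = (\<Sum>s\<in>F. \<Sum>t\<in>F. u s * u t * ((\<Sum>n=1..N. cos (real n * (s - t) / real N)) / real N))"
        unfolding sum_distrib_left[symmetric] sum_trig_weight_product[OF elim] by simp
      finally show ?case by simp
    qed
    moreover have "(\<lambda>N. \<Sum>s\<in>F. \<Sum>t\<in>F. u s * u t * ((\<Sum>n=1..N. cos (real n * (s - t) / real N)) / real N))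
      \<longlonglongrightarrow> (\<Sum>s\<in>F. \<Sum>t\<in>F. u s * u t * sinc (s - t))"
      by (intro tendsto_sum tendsto_mult_left riemann_sum_cos)
    ultimately show "(\<lambda>N. \<Sum>i\<in>?J N. (?w N i)\<^sup>2) \<longlonglongrightarrow> (\<Sum>s\<in>F. \<Sum>t\<in>F. u s * u t * sinc (s - t))"
      by (rule Lim_transform_eventually[rotated])
  qed (use assms in auto)
qed

section \<open>Convergence of the number of zeros\<close>

lemma smooth_derivatives:
  assumes "smooth y"
  shows "(y has_real_derivative deriv y t) (at t)"
    "(deriv y has_real_derivative deriv (deriv y) t) (at t)"
    "continuous_on UNIV (deriv (deriv y))"
proof -
  have d: "(deriv ^^ p) y differentiable_on UNIV" for p using assms by (simp add: smooth_def)
  have "(deriv ^^ p) y field_differentiable (at t)" for p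
  proof -
    have "(deriv ^^ p) y differentiable (at t)" using d[of p] by (simp add: differentiable_on_def)
    then show ?thesis by (auto simp: real_differentiable_def field_differentiable_def)
  qed
  from DERIV_deriv_iff_field_differentiable[THEN iffD2, OF this]
  have D: "((deriv ^^ p) y has_real_derivative deriv ((deriv ^^ p) y) t) (at t)" for p .
  show "(y has_real_derivative deriv y t) (at t)" using D[of 0] by simp
  show "(deriv y has_real_derivative deriv (deriv y) t) (at t)" using D[of 1] by simp
  show "continuous_on UNIV (deriv (deriv y))"
    using differentiable_imp_continuous_on[OF d[of 2]] by (simp add: numeral_2_eq_2)
qed

text \<open>
  Pathwise derivatives are limits of difference quotients.
\<close>
lemma measurable_pathwise_derivative:
  fixes Y Y' :: "real \<Rightarrow> 'a \<Rightarrow> real"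
  assumes meas[measurable]: "\<And>t. Y t \<in> borel_measurable M"
    and der: "\<And>\<omega>. \<omega> \<in> space M \<Longrightarrow> ((\<lambda>t. Y t \<omega>) has_real_derivative Y' t \<omega>) (at t)"
  shows "Y' t \<in> borel_measurable M"
proof (rule borel_measurable_LIMSEQ_real)
  let ?h = "\<lambda>n. inverse (real (Suc n))"
  show "(\<lambda>\<omega>. (Y (t + ?h n) \<omega> - Y t \<omega>) / ?h n) \<in> borel_measurable M" for n by measurable
  fix \<omega> assume "\<omega> \<in> space M"
  from der[OF this] have "((\<lambda>h. (Y (t + h) \<omega> - Y t \<omega>) / h) \<longlongrightarrow> Y' t \<omega>) (at 0)"
    by (simp add: DERIV_def)
  moreover have "filterlim ?h (at 0) sequentially"
    using LIMSEQ_inverse_real_of_nat by (auto simp: filterlim_at)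
  ultimately show "(\<lambda>n. (Y (t + ?h n) \<omega> - Y t \<omega>) / ?h n) \<longlonglongrightarrow> Y' t \<omega>"
    by (rule filterlim_compose)
qed

lemma smooth_process_C2:
  assumes "prob_space M" and meas: "\<And>t. W t \<in> borel_measurable M"
    and smooth: "\<And>\<omega>. \<omega> \<in> space M \<Longrightarrow> smooth (\<lambda>t. W t \<omega>)"
  shows "C2_process M W (\<lambda>t \<omega>. deriv (\<lambda>t. W t \<omega>) t) (\<lambda>t \<omega>. deriv (deriv (\<lambda>t. W t \<omega>)) t)"
proof -
  interpret prob_space M by fact
  have 1: "(\<lambda>\<omega>. deriv (\<lambda>t. W t \<omega>) t) \<in> borel_measurable M" for t
    by (rule measurable_pathwise_derivative[OF meas smooth_derivatives(1)[OF smooth]])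
  have 2: "(\<lambda>\<omega>. deriv (deriv (\<lambda>t. W t \<omega>)) t) \<in> borel_measurable M" for t
    by (rule measurable_pathwise_derivative[OF 1 smooth_derivatives(2)[OF smooth]])
  show ?thesis
    by unfold_locales (use meas 2 smooth_derivatives[OF smooth] in auto)
qed

theorem theorem1:
  fixes M :: "'a measure" and a b :: "nat \<Rightarrow> 'a \<Rightarrow> real" and \<Psi> :: "real \<Rightarrow> real"
    and M' :: "'b measure" and W :: "real \<Rightarrow> 'b \<Rightarrow> real" and c d :: real
  assumes "prob_space M"
    and indep: "prob_space.indep_vars M (\<lambda>_. borel) (case_sum a b) ({1..} <+> {1..})"
    and ident: "\<And>n. n \<ge> 1 \<Longrightarrow> distr M borel (a n) = distr M borel (a 1)"
      "\<And>n. n \<ge> 1 \<Longrightarrow> distr M borel (b n) = distr M borel (a 1)"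
    and square_integrable: "integrable M (\<lambda>\<omega>. (a 1 \<omega>)\<^sup>2)"
    and mean: "prob_space.expectation M (a 1) = 0"
    and second_moment: "prob_space.expectation M (\<lambda>\<omega>. (a 1 \<omega>)\<^sup>2) = 1"
    and density: "distributed M lborel (a 1) (\<lambda>x. ennreal (exp (- \<Psi> x)))"
    and smooth_\<Psi>: "smooth \<Psi>"
    and deriv_Lq: "\<And>(p::nat) (q::real). p \<ge> 1 \<Longrightarrow> q \<ge> 1 \<Longrightarrow>
      integrable (density lborel (\<lambda>x. ennreal (exp (- \<Psi> x)))) (\<lambda>x. \<bar>(deriv ^^ p) \<Psi> x\<bar> powr q)"
    and "prob_space M'"
    and gaussian: "gaussian_process M' W"
    and centered: "\<And>t. prob_space.expectation M' (W t) = 0"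
    and stationary: "stationary_process M' W"
    and covariance: "\<And>s t. prob_space.expectation M' (\<lambda>\<omega>. W s \<omega> * W t \<omega>) =
      (if s = t then 1 else sin (t - s) / (t - s))"
    and smooth_paths: "\<And>\<omega>. \<omega> \<in> space M' \<Longrightarrow> smooth (\<lambda>t. W t \<omega>)"
    and "c \<le> d"
  shows "converges_in_distribution
    M (\<lambda>N \<omega>. zeros (\<lambda>t. trig_poly a b N t \<omega>) {c..d})
    M' (\<lambda>\<omega>. zeros (\<lambda>t. W t \<omega>) {c..d})"
proof -
  interpret M: prob_space M by fact
  interpret M': prob_space M' by fact
  let ?\<xi> = "case_sum a b" and ?I = "{1::nat..} <+> {1::nat..}" and ?\<mu> = "distr M borel (a 1)"
  let ?D = "trig_poly_derivative ?\<xi>"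
  have rv: "?\<xi> i \<in> borel_measurable M" if "i \<in> ?I" for i
    using indep that unfolding M.indep_vars_def2 by blast
  have a1[measurable]: "a 1 \<in> borel_measurable M" using rv[OF InlI, of 1] by simp
  have iid: "standardized_iid M ?\<xi> ?I ?\<mu>"
  proof (intro standardized_iid.intro standardized_iid_axioms.intro)
    show "prob_space M" by fact
    show "M.indep_vars (\<lambda>_. borel) ?\<xi> ?I" by (rule indep)
    show "distr M borel (?\<xi> i) = ?\<mu>" if "i \<in> ?I" for i
    proof (cases i)
      case (Inl n)
      then have "n \<ge> 1" using that by auto
      then show ?thesis unfolding Inl sum.case by (rule ident(1))
    next
      case (Inr n)
      then have "n \<ge> 1" using that by auto
      then show ?thesis unfolding Inr sum.case by (rule ident(2))
    qed
    show "integrable ?\<mu> (\<lambda>x. x\<^sup>2)" using square_integrable a1 by (subst integrable_distr_eq) auto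
    show "integral\<^sup>L ?\<mu> (\<lambda>x. x\<^sup>2) = 1" using second_moment a1 by (subst integral_distr) auto
    show "integral\<^sup>L ?\<mu> (\<lambda>x. x) = 0" using mean a1 by (subst integral_distr) auto
    show "?I \<noteq> {}" by auto
  qed
  have sub: "{1..N} <+> {1..N} \<subseteq> ?I" for N by auto
  have D_meas: "?D k N t \<in> borel_measurable M" for k N t
    unfolding trig_poly_derivative_def
    by (intro borel_measurable_sum borel_measurable_times borel_measurable_const rv) (use sub in blast)
  have D_joint: "(\<lambda>(\<omega>, s). ?D k N s \<omega>) \<in> borel_measurable (M \<Otimes>\<^sub>M lborel)" for k N
  proof -
    have "(\<lambda>s. trig_weight k N s i) \<in> borel_measurable lborel" for i
      by (cases i) (simp_all add: trig_weight_def)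
    note weight = this
    have "(\<lambda>x. \<Sum>i\<in>{1..N} <+> {1..N}. trig_weight k N (snd x) i * ?\<xi> i (fst x)) \<in> borel_measurable (M \<Otimes>\<^sub>M lborel)"
    proof (intro borel_measurable_sum borel_measurable_times)
      fix i assume i: "i \<in> {1..N} <+> {1..N}"
      show "(\<lambda>x. trig_weight k N (snd x) i) \<in> borel_measurable (M \<Otimes>\<^sub>M lborel)"
        by (rule measurable_compose[OF measurable_snd weight])
      show "(\<lambda>x. ?\<xi> i (fst x)) \<in> borel_measurable (M \<Otimes>\<^sub>M lborel)"
        by (rule measurable_compose[OF measurable_fst rv]) (use i sub in blast)
    qed
    then show ?thesis by (simp add: trig_poly_derivative_def case_prod_beta)
  qed
  have D_C2: "C2_process M (?D 0 N) (?D 1 N) (?D 2 N)" for N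
    by unfold_locales
       (use D_meas continuous_on_trig_poly_derivative has_derivative_trig_poly_derivative[of ?\<xi> 0]
         has_derivative_trig_poly_derivative[of ?\<xi> 1] in \<open>auto simp: numeral_2_eq_2\<close>)
  have W_rv: "gaussian_rv M' (W t)" for t
    using gaussian[unfolded gaussian_process_def, rule_format, of "{t}" "\<lambda>_. 1"] by simp
  have W_C2: "C2_process M' W (\<lambda>t \<omega>. deriv (\<lambda>t. W t \<omega>) t) (\<lambda>t \<omega>. deriv (deriv (\<lambda>t. W t \<omega>)) t)"
    using W_rv by (intro smooth_process_C2 smooth_paths \<open>prob_space M'\<close>) (simp_all add: gaussian_rv_def)
  have cov: "M'.expectation (\<lambda>\<omega>. W s \<omega> * W t \<omega>) = sinc (s - t)" for s t
  proof -
    have "sin (t - s) / (t - s) = sin (s - t) / (s - t)" using sin_minus[of "s - t"] by (simp add: divide_simps) argo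
    then show ?thesis by (simp add: covariance)
  qed
  have char_W: "(\<integral>\<omega>. iexp (\<Sum>t\<in>F. u t * W t \<omega>) \<partial>M') =
      of_real (exp (- (\<Sum>s\<in>F. \<Sum>t\<in>F. u s * u t * sinc (s - t)) / 2))" if "finite F" for F u
    by (rule M'.gaussian_process_iexp[OF gaussian centered cov that])
  have "converges_in_distribution M (\<lambda>N \<omega>. zeros (\<lambda>t. ?D 0 N t \<omega>) {c..d}) M' (\<lambda>\<omega>. zeros (\<lambda>t. W t \<omega>) {c..d})"
  proof (rule zeros_converge_in_distribution[OF D_C2 W_C2])
    show "(\<lambda>N. \<integral>\<omega>. iexp (\<Sum>t\<in>F. u t * ?D 0 N t \<omega>) \<partial>M) \<longlonglongrightarrow> (\<integral>\<omega>. iexp (\<Sum>t\<in>F. u t * W t \<omega>) \<partial>M')"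
      if "finite F" for F u
      unfolding char_W[OF that] by (rule trig_poly_fidi_convergence[OF iid sub that])
    show "(\<integral>\<omega>. iexp (u * W t \<omega>) \<partial>M') = of_real (exp (- u\<^sup>2 / 2))" for u t
      using char_W[of "{t}" "\<lambda>_. u"] by (simp add: power2_eq_square)
    show "integrable M (\<lambda>\<omega>. (?D 0 N t \<omega>)\<^sup>2)" "(\<integral>\<omega>. (?D 0 N t \<omega>)\<^sup>2 \<partial>M) \<le> 1" for N t
      by (rule trig_poly_derivative_second_moment[OF iid sub])+
    show "integrable M' (\<lambda>\<omega>. (W t \<omega>)\<^sup>2)" for t by (rule M'.gaussian_rv_square_integrable[OF W_rv])
    show "(\<integral>\<omega>. (W t \<omega>)\<^sup>2 \<partial>M') \<le> 1" for t
      using cov[of t t] by (simp add: power2_eq_square)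
    show "\<exists>K>0. \<forall>N. measure M (space M - {\<omega>\<in>space M. \<forall>t\<in>{c..d}. \<bar>?D 2 N t \<omega>\<bar> \<le> K}) \<le> \<epsilon>"
      if "0 < \<epsilon>" for \<epsilon>
    proof (intro exI conjI allI)
      show K: "0 < (1 + (d - c)) / \<epsilon>" using that \<open>c \<le> d\<close> by simp
      fix N
      have "measure M (space M - {\<omega>\<in>space M. \<forall>t\<in>{c..d}. \<bar>?D 2 N t \<omega>\<bar> \<le> (1 + (d - c)) / \<epsilon>})
          \<le> (1 + (d - c)) / ((1 + (d - c)) / \<epsilon>)"
        by (rule M.maximal_inequality[where Y'="?D 3 N", OF D_meas D_joint _ continuous_on_trig_poly_derivative
              trig_poly_derivative_second_moment[OF iid sub] trig_poly_derivative_second_moment[OF iid sub] \<open>c \<le> d\<close> K])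
           (use has_derivative_trig_poly_derivative[of ?\<xi> 2] in \<open>simp add: eval_nat_numeral\<close>)
      then show "measure M (space M - {\<omega>\<in>space M. \<forall>t\<in>{c..d}. \<bar>?D 2 N t \<omega>\<bar> \<le> (1 + (d - c)) / \<epsilon>}) \<le> \<epsilon>"
        using \<open>c \<le> d\<close> that by simp
    qed
  qed (rule \<open>c \<le> d\<close>)
  then show ?thesis by (simp only: trig_poly_derivative_0)
qed

end
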